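(* Let $G$ be a connected multigraph and let $H$ be a minor of $G$. If $H$ admits a $d$-dimensional super stable tensegrity realization, then $G$ admits a $d$-dimensional super stable tensegrity realization.
   Context: A multigraph is a finite undirected graph that may contain parallel edges but no loops. A tensegrity realization of $G$ in $\mathbb{R}^d$ is $(G,\sigma,p)$ with $\sigma:E(G)\to\{+,-\}$ and $p:V(G)\to\mathbb{R}^d$ (not necessarily injective). With $V(G)=\{1,\dots,n\}$ and standard basis $\mathbf{e}_i$, for $\omega:E(G)\to\mathbb{R}$ put $L_{G,\omega}=\sum_{e\in E(G)}\omega(e)(\mathbf{e}_i-\mathbf{e}_j)(\mathbf{e}_i-\mathbf{e}_j)^\top$ ($i,j$ endpoints of $e$). $\omega$ is an equilibrium stress if $\sum_{e \text{ joins } i,j}\omega(e)(p(j)-p(i))=0$ for every vertex $i$, strictly proper if $\sigma(e)\omega(e)>0$ for all $e$. A tensegrity $(G,\sigma,p)$ whose points affinely span $\mathbb{R}^d$ is a $d$-dimensional super stable tensegrity if (i) some strictly proper equilibrium stress $\omega$ has $L_{G,\omega}\succeq0$ and $\dim\ker L_{G,\omega}=d+1$, and (ii) no nonzero symmetric $d\times d$ matrix $S$ has $(p(j)-p(i))^\top S(p(j)-p(i))=0$ for all edges $ij$. Minors: obtained by deleting vertices/edges and contracting edges, with loops created by contraction deleted. *)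

theory Defs
  imports "HOL-Analysis.Analysis" "HOL-Analysis.Finite_Function_Topology" "HOL-Library.Uprod"
begin

record ('v, 'e) pre_multigraph =
  verts :: "'v set"
  edges :: "'e set"
  ends :: "'e \<Rightarrow> 'v uprod"

text \<open>Edges are named, so parallel edges are distinct names with the same unordered pair of ends;
  \<^const>\<open>proper_uprod\<close> says that the two ends differ, i.e. excludes loops.\<close>

definition multigraph :: "('v, 'e) pre_multigraph \<Rightarrow> bool" where
  "multigraph G \<longleftrightarrow> finite (verts G) \<and> finite (edges G) \<and>
     (\<forall>e\<in>edges G. set_uprod (ends G e) \<subseteq> verts G \<and> proper_uprod (ends G e))"

definition adjacency :: "('v, 'e) pre_multigraph \<Rightarrow> ('v \<times> 'v) set" where
  "adjacency G = {(u, v). \<exists>e\<in>edges G. ends G e = Upair u v}"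

definition connected_multigraph :: "('v, 'e) pre_multigraph \<Rightarrow> bool" where
  "connected_multigraph G \<longleftrightarrow>
     verts G \<noteq> {} \<and> (\<forall>u\<in>verts G. \<forall>v\<in>verts G. (u, v) \<in> (adjacency G)\<^sup>*)"


definition delete_vertex :: "'v \<Rightarrow> ('v, 'e) pre_multigraph \<Rightarrow> ('v, 'e) pre_multigraph" where
  "delete_vertex v G =
     \<lparr>verts = verts G - {v}, edges = {e \<in> edges G. v \<notin> set_uprod (ends G e)}, ends = ends G\<rparr>"

definition delete_edge :: "'e \<Rightarrow> ('v, 'e) pre_multigraph \<Rightarrow> ('v, 'e) pre_multigraph" where
  "delete_edge e G = \<lparr>verts = verts G, edges = edges G - {e}, ends = ends G\<rparr>"

text \<open>Identify \<open>v\<close> with \<open>u\<close>, keep the name \<open>u\<close>, and discard the edges that have become loops.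
  For an edge with ends \<open>u\<close> and \<open>v\<close> this is its contraction; the edge itself
  and all edges parallel to it are among the discarded loops.\<close>

definition identify :: "'v \<Rightarrow> 'v \<Rightarrow> ('v, 'e) pre_multigraph \<Rightarrow> ('v, 'e) pre_multigraph" where
  "identify u v G =
     (let ends' = (\<lambda>e. map_uprod (\<lambda>w. if w = v then u else w) (ends G e))
      in \<lparr>verts = verts G - {v}, edges = {e \<in> edges G. proper_uprod (ends' e)}, ends = ends'\<rparr>)"

inductive minor_step :: "('v, 'e) pre_multigraph \<Rightarrow> ('v, 'e) pre_multigraph \<Rightarrow> bool" where
  delete_vertex: "v \<in> verts G \<Longrightarrow> minor_step G (delete_vertex v G)"
| delete_edge: "e \<in> edges G \<Longrightarrow> minor_step G (delete_edge e G)"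
| contract_edge: "e \<in> edges G \<Longrightarrow> ends G e = Upair u v \<Longrightarrow> minor_step G (identify u v G)"

definition isomorphic_multigraph ::
  "('v, 'e) pre_multigraph \<Rightarrow> ('w, 'f) pre_multigraph \<Rightarrow> bool" where
  "isomorphic_multigraph G H \<longleftrightarrow>
     (\<exists>f g. bij_betw f (verts G) (verts H) \<and> bij_betw g (edges G) (edges H) \<and>
        (\<forall>e\<in>edges G. ends H (g e) = map_uprod f (ends G e)))"

definition is_minor :: "('w, 'f) pre_multigraph \<Rightarrow> ('v, 'e) pre_multigraph \<Rightarrow> bool" where
  "is_minor H G \<longleftrightarrow> (\<exists>H'. minor_step\<^sup>*\<^sup>* G H' \<and> isomorphic_multigraph H' H)"

lemma multigraph_minor_step:
  assumes "minor_step G H" "multigraph G"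
  shows "multigraph H"
  using assms
proof cases
  case (contract_edge e u v)
  let ?f = "\<lambda>w. if w = v then u else w"
  have uv: "u \<noteq> v" "u \<in> verts G"
    using contract_edge assms(2) by (auto simp: multigraph_def)
  have "set_uprod (map_uprod ?f (ends G e')) \<subseteq> verts G - {v}" if "e' \<in> edges G" for e'
  proof -
    have "set_uprod (ends G e') \<subseteq> verts G"
      using that assms(2) by (simp add: multigraph_def)
    with uv show ?thesis
      by (cases "ends G e'") simp
  qed
  with contract_edge(1) assms(2) show ?thesis
    by (simp add: multigraph_def identify_def Let_def)
qed (auto simp: multigraph_def delete_vertex_def delete_edge_def)

lemma multigraph_isomorphic:
  assumes "isomorphic_multigraph G H" "multigraph G"
  shows "multigraph H"
proof -
  obtain f g where f: "bij_betw f (verts G) (verts H)" and g: "bij_betw g (edges G) (edges H)"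
    and fg: "\<And>e. e \<in> edges G \<Longrightarrow> ends H (g e) = map_uprod f (ends G e)"
    using assms(1) unfolding isomorphic_multigraph_def by blast
  have "set_uprod (ends H e') \<subseteq> verts H \<and> proper_uprod (ends H e')" if "e' \<in> edges H" for e'
  proof -
    have "e' \<in> g ` edges G"
      using that bij_betw_imp_surj_on[OF g] by simp
    then obtain e where e: "e' = g e" "e \<in> edges G"
      by (rule imageE)
    obtain i j where ij: "ends G e = Upair i j"
      by (rule uprod_exhaust)
    have "i \<in> verts G" "j \<in> verts G" "i \<noteq> j"
      using assms(2) e(2) ij by (force simp: multigraph_def)+
    then have "f i \<in> verts H" "f j \<in> verts H" "f i \<noteq> f j"
      using bij_betwE[OF f] inj_onD[OF bij_betw_imp_inj_on[OF f], of i j] by auto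
    then show ?thesis
      using fg[OF e(2)] e(1) ij by simp
  qed
  then show ?thesis
    using assms(2) bij_betw_finite[OF f] bij_betw_finite[OF g] unfolding multigraph_def by simp
qed

lemma multigraph_minor:
  assumes "is_minor H G" "multigraph G"
  shows "multigraph H"
proof -
  obtain H' where H': "minor_step\<^sup>*\<^sup>* G H'" "isomorphic_multigraph H' H"
    using assms(1) by (auto simp: is_minor_def)
  from H'(1) assms(2) have "multigraph H'"
    by (induction rule: rtranclp_induct) (auto intro: multigraph_minor_step)
  with H'(2) show ?thesis by (rule multigraph_isomorphic)
qed


text \<open>Vectors indexed by the vertices are finitely supported functions with support in
  \<^term>\<open>verts G\<close>, so that \<^term>\<open>Poly_Mapping.single i (1 :: real)\<close> is the
  standard basis vector at \<open>i\<close>; matrices indexed by the vertices are binary functions.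
  \<open>edge_matrix {i, j} u v\<close> is the \<open>(u, v)\<close> entry of
  \<open>(e\<^sub>i - e\<^sub>j) (e\<^sub>i - e\<^sub>j)\<^sup>T\<close>, which does not depend on the order of \<open>i\<close> and \<open>j\<close>.\<close>

lift_definition edge_matrix :: "'v uprod \<Rightarrow> 'v \<Rightarrow> 'v \<Rightarrow> real" is
  "\<lambda>(i, j) u v. let b = Poly_Mapping.single i (1 :: real) - Poly_Mapping.single j 1
     in poly_mapping.lookup b u * poly_mapping.lookup b v"
  by (auto simp: fun_eq_iff lookup_minus Let_def algebra_simps)

lemma edge_matrix_Upair:
  "edge_matrix (Upair i j) u v =
     poly_mapping.lookup (Poly_Mapping.single i 1 - Poly_Mapping.single j 1) u *
     poly_mapping.lookup (Poly_Mapping.single i 1 - Poly_Mapping.single j 1) v"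
  unfolding Upair.abs_eq edge_matrix.abs_eq by (simp add: Let_def)

definition laplacian :: "('v, 'e) pre_multigraph \<Rightarrow> ('e \<Rightarrow> real) \<Rightarrow> 'v \<Rightarrow> 'v \<Rightarrow> real" where
  "laplacian G \<omega> u v = (\<Sum>e\<in>edges G. \<omega> e * edge_matrix (ends G e) u v)"

definition psd_on :: "'v set \<Rightarrow> ('v \<Rightarrow> 'v \<Rightarrow> real) \<Rightarrow> bool" where
  "psd_on V L \<longleftrightarrow> (\<forall>u\<in>V. \<forall>v\<in>V. L u v = L v u) \<and>
     (\<forall>x :: 'v \<Rightarrow>\<^sub>0 real. Poly_Mapping.keys x \<subseteq> V \<longrightarrow>
        (\<Sum>u\<in>V. \<Sum>v\<in>V. poly_mapping.lookup x u * L u v * poly_mapping.lookup x v) \<ge> 0)"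

definition kernel_on :: "'v set \<Rightarrow> ('v \<Rightarrow> 'v \<Rightarrow> real) \<Rightarrow> ('v \<Rightarrow>\<^sub>0 real) set" where
  "kernel_on V L = {x. Poly_Mapping.keys x \<subseteq> V \<and>
     (\<forall>u\<in>V. (\<Sum>v\<in>V. L u v * poly_mapping.lookup x v) = 0)}"


datatype sign = Plus | Minus

primrec sign_val :: "sign \<Rightarrow> real" where
  "sign_val Plus = 1"
| "sign_val Minus = -1"

definition equilibrium_stress ::
  "('v, 'e) pre_multigraph \<Rightarrow> ('v \<Rightarrow> real ^ 'd) \<Rightarrow> ('e \<Rightarrow> real) \<Rightarrow> bool" where
  "equilibrium_stress G p \<omega> \<longleftrightarrow>
     (\<forall>i\<in>verts G.
        (\<Sum>j\<in>verts G. \<Sum>e\<in>{e \<in> edges G. ends G e = Upair i j}. \<omega> e *\<^sub>R (p j - p i)) = 0)"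

definition strictly_proper ::
  "('v, 'e) pre_multigraph \<Rightarrow> ('e \<Rightarrow> sign) \<Rightarrow> ('e \<Rightarrow> real) \<Rightarrow> bool" where
  "strictly_proper G \<sigma> \<omega> \<longleftrightarrow> (\<forall>e\<in>edges G. sign_val (\<sigma> e) * \<omega> e > 0)"

definition super_stable ::
  "('v, 'e) pre_multigraph \<Rightarrow> ('e \<Rightarrow> sign) \<Rightarrow> ('v \<Rightarrow> real ^ 'd) \<Rightarrow> bool" where
  "super_stable G \<sigma> p \<longleftrightarrow>
     affine hull (p ` verts G) = UNIV \<and>
     (\<exists>\<omega>. equilibrium_stress G p \<omega> \<and> strictly_proper G \<sigma> \<omega> \<and>
        psd_on (verts G) (laplacian G \<omega>) \<and>
        dim (kernel_on (verts G) (laplacian G \<omega>)) = CARD('d) + 1) \<and>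
     \<not> (\<exists>S :: real ^ 'd ^ 'd. S \<noteq> 0 \<and> transpose S = S \<and>
          (\<forall>e\<in>edges G. \<forall>i j. ends G e = Upair i j \<longrightarrow>
             (p j - p i) \<bullet> (S *v (p j - p i)) = 0))"

end

theory Submission
  imports Defs
begin

text \<open>
  A connected spanning minor model of \<open>H\<close> in \<open>G\<close> partitions the edges of \<open>G\<close> into edges inside the
  fibres, edges representing \<open>H\<close>, and others. Give them weights \<open>1 / \<epsilon>\<close>, \<open>\<omega> + c\<close> and \<open>\<epsilon>\<close>, where
  \<open>\<omega>\<close> is the stress of \<open>H\<close> and \<open>c\<close> is a small correction. Pin an affine basis of the points of \<open>H\<close>
  and extend it to \<open>G\<close> harmonically. The pinned energy stays coercive, so the extension is a
  super stable realization as soon as the \<open>d \<times> d\<close> matrix \<open>F\<close> of its total energies vanishes.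
  Condition (ii) for \<open>H\<close> says that \<open>c\<close> can be chosen linearly in a symmetric matrix \<open>X\<close> so that
  the first-order change of the energies is \<open>X\<close>; then \<open>F X = X + O(\<epsilon> + \<bar>X\<bar>\<^sup>2)\<close>. Being a minimum, the
  energy is concave in \<open>X\<close>, hence \<open>F\<close> is continuous, and Brouwer's theorem applied to \<open>X - F X\<close>
  on a small ball of symmetric matrices gives a zero of \<open>F\<close>.
\<close>

section \<open>Minor models\<close>

text \<open>The obstacle is exactness: the energy must stay nonnegative and its kernel must have
  dimension exactly d + 1, although an arbitrary small change of a stress need not preserve either.
  Pinning separates what is stable from what is not. On functions vanishing at the pinned vertices
  the energy is positive definite, an open condition. Every function is an affine function of the
  harmonic coordinates plus one that vanishes at the pinned vertices, and the coordinates are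
  orthogonal to the latter. So only the d(d + 1) / 2 mutual energies of the coordinates can spoil
  nonnegativity or the kernel. Condition (ii) supplies exactly as many parameters: it says that the
  matrices v v^T, v an edge vector of \<open>H\<close>, span the symmetric matrices. The remaining
  error is of second order in the correction because, by stationarity, the displacement z from the
  old realization P satisfies E(z, z) = - E(P, z), and E(P, z) is small by the equilibrium in
  \<open>H\<close>. Brouwer's theorem asks only for continuity, and concavity provides it without
  following how the minimizer depends on X.\<close>

definition fibre_adjacency ::
  "('v, 'e) pre_multigraph \<Rightarrow> 'v set \<Rightarrow> ('v \<Rightarrow> 'w) \<Rightarrow> ('v \<times> 'v) set" where
  "fibre_adjacency G D \<phi> = {(a, b). (a, b) \<in> adjacency G \<and> a \<in> D \<and> b \<in> D \<and> \<phi> a = \<phi> b}"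

text \<open>A certificate for a minor that forgets the order of the steps. The fibres of \<phi> in
  \<open>D\<close> are the branch sets, connected by the third clause; vertices outside
  \<open>D\<close> are deleted; \<psi> names the edge of \<open>G\<close> that represents an edge of
  \<open>H\<close>.\<close>

definition minor_model :: "('v, 'e) pre_multigraph \<Rightarrow> ('w, 'f) pre_multigraph \<Rightarrow>
    'v set \<Rightarrow> ('v \<Rightarrow> 'w) \<Rightarrow> ('f \<Rightarrow> 'e) \<Rightarrow> bool" where
  "minor_model G H D \<phi> \<psi> \<longleftrightarrow>
     D \<subseteq> verts G \<and> \<phi> ` D = verts H \<and>
     (\<forall>a\<in>D. \<forall>b\<in>D. \<phi> a = \<phi> b \<longrightarrow> (a, b) \<in> (fibre_adjacency G D \<phi>)\<^sup>*) \<and>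
     inj_on \<psi> (edges H) \<and>
     (\<forall>e\<in>edges H. \<psi> e \<in> edges G \<and> set_uprod (ends G (\<psi> e)) \<subseteq> D \<and>
        map_uprod \<phi> (ends G (\<psi> e)) = ends H e)"

lemma minor_modelD:
  assumes "minor_model G H D \<phi> \<psi>"
  shows "D \<subseteq> verts G" "\<phi> ` D = verts H"
    "\<And>a b. a \<in> D \<Longrightarrow> b \<in> D \<Longrightarrow> \<phi> a = \<phi> b \<Longrightarrow> (a, b) \<in> (fibre_adjacency G D \<phi>)\<^sup>*"
    "inj_on \<psi> (edges H)"
    "\<And>e. e \<in> edges H \<Longrightarrow> \<psi> e \<in> edges G"
    "\<And>e. e \<in> edges H \<Longrightarrow> set_uprod (ends G (\<psi> e)) \<subseteq> D"
    "\<And>e. e \<in> edges H \<Longrightarrow> map_uprod \<phi> (ends G (\<psi> e)) = ends H e"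
  using assms unfolding minor_model_def by blast+

lemma sym_adjacency: "(a, b) \<in> adjacency G \<Longrightarrow> (b, a) \<in> adjacency G"
  unfolding adjacency_def by (simp add: split_beta) (metis Upair_inject)

text \<open>A path of this relation never leaves the fibre where it starts, so only the edges of
  that one fibre have to be transported.\<close>

lemma fibre_adjacency_cong:
  assumes "(a, b) \<in> (fibre_adjacency G D \<phi>)\<^sup>*"
    and "\<And>x y. (x, y) \<in> fibre_adjacency G D \<phi> \<Longrightarrow> \<phi> x = \<phi> a \<Longrightarrow> (x, y) \<in> fibre_adjacency G D' \<phi>'"
  shows "(a, b) \<in> (fibre_adjacency G D' \<phi>')\<^sup>*"
proof -
  have "\<phi> b = \<phi> a \<and> (a, b) \<in> (fibre_adjacency G D' \<phi>')\<^sup>*"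
    using assms(1)
  proof (induction rule: rtrancl_induct)
    case (step y z)
    then have "\<phi> z = \<phi> a" by (simp add: fibre_adjacency_def)
    moreover have "(y, z) \<in> fibre_adjacency G D' \<phi>'" using step assms(2) by blast
    ultimately show ?case using step.IH by (meson rtrancl.rtrancl_into_rtrancl)
  qed simp
  then show ?thesis ..
qed

lemma minor_model_refl:
  assumes "multigraph G"
  shows "minor_model G G (verts G) id id"
  using assms by (auto simp: minor_model_def multigraph_def uprod.map_id)

text \<open>Edge names survive every step, so \<psi> stays the same. Deleting a vertex discards its
  fibre; contracting \<open>e\<close> merges two fibres, which the edge \<open>\<psi> e\<close>
  links.\<close>

lemma minor_model_step:
  assumes model: "minor_model G H D \<phi> \<psi>" and step: "minor_step H H'" and H: "multigraph H"
  shows "\<exists>D' \<phi>'. minor_model G H' D' \<phi>' \<psi>"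
  using step
proof cases
  case (delete_vertex v)
  let ?D = "{a \<in> D. \<phi> a \<noteq> v}"
  note m = minor_modelD[OF model]
  have "minor_model G H' ?D \<phi> \<psi>"
    unfolding minor_model_def
  proof (intro conjI ballI impI)
    show "(a, b) \<in> (fibre_adjacency G ?D \<phi>)\<^sup>*" if "a \<in> ?D" "b \<in> ?D" "\<phi> a = \<phi> b" for a b
    proof (rule fibre_adjacency_cong)
      show "(a, b) \<in> (fibre_adjacency G D \<phi>)\<^sup>*" using m(3) that by blast
    qed (use that in \<open>auto simp: fibre_adjacency_def\<close>)
    show "set_uprod (ends G (\<psi> e)) \<subseteq> ?D" if "e \<in> edges H'" for e
    proof -
      have e: "e \<in> edges H" "v \<notin> set_uprod (ends H e)"
        using that delete_vertex by (auto simp: Defs.delete_vertex_def)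
      then have "v \<notin> \<phi> ` set_uprod (ends G (\<psi> e))"
        using m(7)[OF e(1)] by (metis uprod.set_map)
      then show ?thesis using m(6)[OF e(1)] by auto
    qed
  qed (use delete_vertex m in \<open>auto simp: Defs.delete_vertex_def inj_on_def\<close>)
  then show ?thesis by blast
next
  case (delete_edge e)
  have "minor_model G H' D \<phi> \<psi>"
    using model delete_edge by (auto simp: minor_model_def delete_edge_def inj_on_def)
  then show ?thesis by blast
next
  case (contract_edge e u v)
  note m = minor_modelD[OF model]
  let ?f = "\<lambda>w. if w = v then u else w"
  let ?\<phi> = "?f \<circ> \<phi>"
  have uv: "u \<noteq> v" "u \<in> verts H" "v \<in> verts H"
    using contract_edge H by (force simp: multigraph_def)+
  obtain a' b' where ab': "ends G (\<psi> e) = Upair a' b'" by (rule uprod_exhaust)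
  with m(7)[of e] contract_edge have "Upair (\<phi> a') (\<phi> b') = Upair u v" by simp
  with ab' obtain a b where ab: "ends G (\<psi> e) = Upair a b" "\<phi> a = u" "\<phi> b = v"
    by (metis Upair_inject)
  have abD: "a \<in> D" "b \<in> D" using m(6)[of e] contract_edge ab by auto
  have ab_adj: "(a, b) \<in> adjacency G" 
    using ab m(5)[of e] contract_edge by (auto simp: adjacency_def)
  let ?R = "fibre_adjacency G D ?\<phi>"
  have ab_R: "(a, b) \<in> ?R" "(b, a) \<in> ?R"
    using ab_adj sym_adjacency[OF ab_adj] abD ab by (auto simp: fibre_adjacency_def)
  \<comment> \<open>Merging values of \<phi> only enlarges the relation, so the old fibres stay
    connected.\<close>
  have old: "(x, y) \<in> ?R\<^sup>*" if "x \<in> D" "y \<in> D" "\<phi> x = \<phi> y" for x y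
    by (rule fibre_adjacency_cong[OF m(3)[OF that]]) (auto simp: fibre_adjacency_def)
  have "minor_model G H' D ?\<phi> \<psi>"
    unfolding minor_model_def
  proof (intro conjI ballI impI)
    show "(x, y) \<in> ?R\<^sup>*" if xy: "x \<in> D" "y \<in> D" "?\<phi> x = ?\<phi> y" for x y
    proof -
      consider "\<phi> x = \<phi> y" | "\<phi> x = u" "\<phi> y = v" | "\<phi> x = v" "\<phi> y = u"
        using xy(3) by (auto split: if_splits)
      then show ?thesis
      proof cases
        case 2
        then have "(x, a) \<in> ?R\<^sup>*" "(b, y) \<in> ?R\<^sup>*" using old xy abD ab by auto
        then show ?thesis using ab_R by (meson rtrancl_trans rtrancl.rtrancl_into_rtrancl)
      next
        case 3
        then have "(x, b) \<in> ?R\<^sup>*" "(a, y) \<in> ?R\<^sup>*" using old xy abD ab by auto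
        then show ?thesis using ab_R by (meson rtrancl_trans rtrancl.rtrancl_into_rtrancl)
      qed (use old xy in blast)
    qed
    have "?f ` verts H = verts H - {v}" using uv by auto
    then show "?\<phi> ` D = verts H'"
      using m(2) contract_edge by (simp only: image_comp[symmetric] identify_def Let_def pre_multigraph.select_convs)
    show "map_uprod ?\<phi> (ends G (\<psi> e')) = ends H' e'" if "e' \<in> edges H'" for e'
    proof -
      have "e' \<in> edges H" using that contract_edge by (auto simp: identify_def Let_def)
      moreover have "ends H' e' = map_uprod ?f (ends H e')"
        using contract_edge by (simp add: identify_def Let_def)
      ultimately show ?thesis using m(7)[of e'] by (metis uprod.map_comp)
    qed
  qed (use contract_edge m in \<open>auto simp: identify_def Let_def inj_on_def\<close>)
  then show ?thesis by blast
qed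

lemma minor_model_isomorphic:
  assumes model: "minor_model G H D \<phi> \<psi>" and iso: "isomorphic_multigraph H H'"
    and H: "multigraph H"
  shows "\<exists>D' \<phi>' \<psi>'. minor_model G H' D' \<phi>' \<psi>'"
proof -
  obtain f g where f: "bij_betw f (verts H) (verts H')" and g: "bij_betw g (edges H) (edges H')"
    and fg: "\<And>e. e \<in> edges H \<Longrightarrow> ends H' (g e) = map_uprod f (ends H e)"
    using iso unfolding isomorphic_multigraph_def by blast
  note m = minor_modelD[OF model]
  let ?h = "inv_into (edges H) g"
  have h: "?h e \<in> edges H" "g (?h e) = e" if "e \<in> edges H'" for e
    using that g by (metis bij_betw_imp_surj_on inv_into_into, metis bij_betw_inv_into_right)
  have "minor_model G H' D (f \<circ> \<phi>) (\<psi> \<circ> ?h)"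
    unfolding minor_model_def
  proof (intro conjI ballI impI)
    show "(f \<circ> \<phi>) ` D = verts H'"
      using f m(2) by (metis bij_betw_imp_surj_on image_comp)
    show "(a, b) \<in> (fibre_adjacency G D (f \<circ> \<phi>))\<^sup>*"
      if "a \<in> D" "b \<in> D" "(f \<circ> \<phi>) a = (f \<circ> \<phi>) b" for a b
    proof -
      have "\<phi> a = \<phi> b"
        using that m(2) bij_betw_imp_inj_on[OF f] by (metis comp_apply image_eqI inj_onD)
      then show ?thesis
        by (rule fibre_adjacency_cong[OF m(3)[OF that(1,2)]]) (auto simp: fibre_adjacency_def)
    qed
    show "inj_on (\<psi> \<circ> ?h) (edges H')"
    proof (rule comp_inj_on)
      show "inj_on ?h (edges H')" by (metis bij_betw_imp_inj_on bij_betw_inv_into g)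
      show "inj_on \<psi> (?h ` edges H')" 
        using m(4) h by (meson image_subsetI inj_on_subset)
    qed
    show "map_uprod (f \<circ> \<phi>) (ends G ((\<psi> \<circ> ?h) e)) = ends H' e" if "e \<in> edges H'" for e
      using m(7)[OF h(1)[OF that]] fg[OF h(1)[OF that]] h(2)[OF that]
      by (simp add: uprod.map_comp[symmetric])
  qed (use m h in auto)
  then show ?thesis by blast
qed

lemma minor_model_exists:
  assumes "is_minor H G" "multigraph G"
  shows "\<exists>D \<phi> \<psi>. minor_model G H D \<phi> \<psi>"
proof -
  obtain H' where H': "minor_step\<^sup>*\<^sup>* G H'" "isomorphic_multigraph H' H"
    using assms(1) by (auto simp: is_minor_def)
  from H'(1) have "multigraph H' \<and> (\<exists>D \<phi> \<psi>. minor_model G H' D \<phi> \<psi>)"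
  proof (induction rule: rtranclp_induct)
    case base
    then show ?case using assms(2) minor_model_refl by blast
  next
    case (step H1 H2)
    then show ?case by (meson minor_model_step multigraph_minor_step)
  qed
  then show ?thesis using H'(2) minor_model_isomorphic by blast
qed

text \<open>The vertex \<open>b\<close> joins the fibre of its neighbour \<open>a\<close>. The edges
  chosen by \<psi> have their ends in \<open>D\<close>, so they do not notice.\<close>

lemma minor_model_extend:
  assumes model: "minor_model G H D \<phi> \<psi>"
    and ab: "(a, b) \<in> adjacency G" "a \<in> D" "b \<notin> D" "b \<in> verts G"
  shows "minor_model G H (insert b D) (\<phi>(b := \<phi> a)) \<psi>"
proof -
  note m = minor_modelD[OF model]
  let ?\<phi> = "\<phi>(b := \<phi> a)"
  let ?R = "fibre_adjacency G (insert b D) ?\<phi>"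
  have ab_R: "(a, b) \<in> ?R" "(b, a) \<in> ?R"
    using ab sym_adjacency[OF ab(1)] by (auto simp: fibre_adjacency_def)
  have old: "(x, y) \<in> ?R\<^sup>*" if "x \<in> D" "y \<in> D" "\<phi> x = \<phi> y" for x y
    by (rule fibre_adjacency_cong[OF m(3)[OF that]]) (use ab in \<open>auto simp: fibre_adjacency_def\<close>)
  show ?thesis
    unfolding minor_model_def
  proof (intro conjI ballI impI)
    show "(x, y) \<in> ?R\<^sup>*" if "x \<in> insert b D" "y \<in> insert b D" "?\<phi> x = ?\<phi> y" for x y
      using that old[of x y] old[of a y] old[of x a] ab_R ab
      by (cases "x = b"; cases "y = b")
        (auto intro: rtrancl.rtrancl_into_rtrancl converse_rtrancl_into_rtrancl)
    have "?\<phi> ` D = \<phi> ` D" using ab by (intro image_cong) auto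
    then show "?\<phi> ` insert b D = verts H" using m(2) ab by auto
    show "map_uprod ?\<phi> (ends G (\<psi> e)) = ends H e" if "e \<in> edges H" for e
    proof -
      have "map_uprod ?\<phi> (ends G (\<psi> e)) = map_uprod \<phi> (ends G (\<psi> e))"
        by (rule uprod.map_cong) (use m(6)[OF that] ab in auto)
      then show ?thesis using m(7)[OF that] by simp
    qed
    show "set_uprod (ends G (\<psi> e)) \<subseteq> insert b D" if "e \<in> edges H" for e
      using m(6)[OF that] by blast
  qed (use m ab in auto)
qed

lemma spanning_minor_model:
  assumes minor: "is_minor H G" and G: "multigraph G" "connected_multigraph G"
    and H: "verts H \<noteq> {}"
  obtains \<phi> \<psi> where "minor_model G H (verts G) \<phi> \<psi>"
proof -
  have fin: "finite (verts G)" using G by (simp add: multigraph_def)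
  have "\<exists>\<phi>' \<psi>'. minor_model G H (verts G) \<phi>' \<psi>'" if "minor_model G H D \<phi> \<psi>" for D \<phi> \<psi>
    using that
  proof (induction "card (verts G - D)" arbitrary: D \<phi> \<psi> rule: less_induct)
    case less
    note m = minor_modelD[OF less.prems]
    show ?case
    proof (cases "D = verts G")
      case True
      then show ?thesis using less.prems by blast
    next
      case False
      then obtain w where w: "w \<in> verts G" "w \<notin> D" using m(1) by blast
      obtain u where u: "u \<in> D" using m(2) H by blast
      have "(u, w) \<in> (adjacency G)\<^sup>*"
        using G(2) u w m(1) by (auto simp: connected_multigraph_def)
      then have "\<exists>a b. (a, b) \<in> adjacency G \<and> a \<in> D \<and> b \<notin> D"
        using w(2) u by (induction rule: rtrancl_induct) auto
      then obtain a b where ab: "(a, b) \<in> adjacency G" "a \<in> D" "b \<notin> D" by blast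
      then have b: "b \<in> verts G"
        using G(1) by (force simp: adjacency_def multigraph_def)
      have "verts G - insert b D \<subset> verts G - D" using b ab by blast
      then show ?thesis
        using less.hyps[OF _ minor_model_extend[OF less.prems ab b]] fin
        by (meson finite_Diff psubset_card_mono)
    qed
  qed
  then show ?thesis using minor_model_exists[OF minor G(1)] that by blast
qed

section \<open>Super stability through the energy form\<close>

text \<open>This is x^T L y for the Laplacian L of the weights. The edge set is a parameter so that
  the energy can be split into classes of edges; the orientation has no influence, since each edge
  contributes a product of two differences.\<close>

definition edge_form ::
  "('e \<Rightarrow> 'v) \<Rightarrow> ('e \<Rightarrow> 'v) \<Rightarrow> 'e set \<Rightarrow> ('e \<Rightarrow> real) \<Rightarrow> ('v \<Rightarrow> real) \<Rightarrow> ('v \<Rightarrow> real) \<Rightarrow> real" where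
  "edge_form s t E w x y = (\<Sum>e\<in>E. w e * (x (s e) - x (t e)) * (y (s e) - y (t e)))"

lemma poly_mapping_of_fun:
  assumes "finite V"
  shows "\<exists>q :: 'v \<Rightarrow>\<^sub>0 real. Poly_Mapping.keys q \<subseteq> V \<and> (\<forall>v\<in>V. poly_mapping.lookup q v = x v)"
proof -
  have "finite {v. (if v \<in> V then x v else 0) \<noteq> 0}"
    by (rule finite_subset[OF _ assms]) (auto split: if_splits)
  then have "poly_mapping.lookup (Abs_poly_mapping (\<lambda>v. if v \<in> V then x v else 0)) =
      (\<lambda>v. if v \<in> V then x v else 0)"
    by (rule lookup_Abs_poly_mapping)
  then show ?thesis
    by (intro exI[of _ "Abs_poly_mapping (\<lambda>v. if v \<in> V then x v else 0)"])
      (auto simp: in_keys_iff split: if_splits)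
qed

lemma lookup_scaleR: "poly_mapping.lookup (r *\<^sub>R q) v = r *\<^sub>R poly_mapping.lookup q v"
proof -
  have "finite {v. r *\<^sub>R poly_mapping.lookup q v \<noteq> 0}"
    by (rule finite_subset[OF _ finite_keys[of q]]) (auto simp: in_keys_iff)
  then show ?thesis by (simp add: scaleR_poly_mapping_def)
qed

text \<open>Constants have zero differences, so only the linear part contributes, one coordinate at
  a time.\<close>

lemma edge_form_affine:
  fixes p :: "'v \<Rightarrow> real ^ 'd"
  assumes "\<And>k. edge_form s t E w x (\<lambda>v. p v $ k) = 0"
  shows "edge_form s t E w x (\<lambda>v. b + a \<bullet> p v) = 0"
proof -
  have "edge_form s t E w x (\<lambda>v. b + a \<bullet> p v) = (\<Sum>k\<in>UNIV. a $ k * edge_form s t E w x (\<lambda>v. p v $ k))"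
    unfolding edge_form_def sum_distrib_left
    by (subst sum.swap) (simp add: inner_vec_def sum_subtractf right_diff_distrib sum_distrib_left
        sum_distrib_right mult_ac)
  then show ?thesis using assms by simp
qed

lemma affine_functional_zero:
  fixes a :: "real ^ 'd"
  assumes "affine hull Q = UNIV" "\<And>q. q \<in> Q \<Longrightarrow> b + a \<bullet> q = 0"
  shows "a = 0 \<and> b = 0"
proof -
  have "Q \<subseteq> {q. a \<bullet> q = - b}" using assms(2) by (force simp: algebra_simps)
  then have "affine hull Q \<subseteq> {q. a \<bullet> q = - b}"
    by (simp add: affine_hyperplane subset_hull)
  then have all: "a \<bullet> q = - b" for q using assms(1) by auto
  have "b = 0" using all[of 0] by simp
  then show ?thesis using all[of a] by simp
qed

locale oriented_multigraph =
  fixes G :: "('v, 'e) pre_multigraph" and s t :: "'e \<Rightarrow> 'v"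
  assumes multigraph: "multigraph G"
    and orient: "\<And>e. e \<in> edges G \<Longrightarrow> ends G e = Upair (s e) (t e)"
begin

abbreviation form :: "('e \<Rightarrow> real) \<Rightarrow> ('v \<Rightarrow> real) \<Rightarrow> ('v \<Rightarrow> real) \<Rightarrow> real" where
  "form \<equiv> edge_form s t (edges G)"

lemma finite_verts: "finite (verts G)" and finite_edges: "finite (edges G)"
  using multigraph by (auto simp: multigraph_def)

lemma ends_verts: "e \<in> edges G \<Longrightarrow> s e \<in> verts G" "e \<in> edges G \<Longrightarrow> t e \<in> verts G"
  and ends_neq: "e \<in> edges G \<Longrightarrow> s e \<noteq> t e"
  using multigraph orient by (force simp: multigraph_def)+

lemma laplacian_form:
  "(\<Sum>u\<in>verts G. \<Sum>v\<in>verts G. x u * laplacian G w u v * y v) = form w x y"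
proof -
  let ?V = "verts G"
  \<comment> \<open>The vector e_i - e_j of the edge. Each edge matrix is of rank one, so the double
    sum factors edge by edge.\<close>
  define b where "b e u = poly_mapping.lookup
    (Poly_Mapping.single (s e) 1 - Poly_Mapping.single (t e) 1 :: 'v \<Rightarrow>\<^sub>0 real) u" for e u
  have b: "(\<Sum>u\<in>?V. x u * b e u) = x (s e) - x (t e)" if "e \<in> edges G" for e x
    using ends_verts[OF that] finite_verts
    by (simp add: b_def lookup_minus lookup_single right_diff_distrib sum_subtractf when_def
        sum.delta' if_distrib[of "\<lambda>z. _ * z"] cong: if_cong)
  have "(\<Sum>u\<in>?V. \<Sum>v\<in>?V. x u * laplacian G w u v * y v) =
      (\<Sum>u\<in>?V. \<Sum>v\<in>?V. \<Sum>e\<in>edges G. w e * (x u * b e u) * (y v * b e v))"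
    unfolding laplacian_def sum_distrib_left sum_distrib_right
    by (intro sum.cong refl) (simp add: orient edge_matrix_Upair b_def)
  also have "\<dots> = (\<Sum>u\<in>?V. \<Sum>e\<in>edges G. \<Sum>v\<in>?V. w e * (x u * b e u) * (y v * b e v))"
    by (rule sum.cong[OF refl], rule sum.swap)
  also have "\<dots> = (\<Sum>e\<in>edges G. \<Sum>u\<in>?V. \<Sum>v\<in>?V. w e * (x u * b e u) * (y v * b e v))"
    by (rule sum.swap)
  also have "\<dots> = (\<Sum>e\<in>edges G. w e * (\<Sum>u\<in>?V. x u * b e u) * (\<Sum>v\<in>?V. y v * b e v))"
    unfolding mult.assoc sum_product by (simp add: sum_distrib_left mult.assoc)
  also have "\<dots> = form w x y"
    unfolding edge_form_def by (intro sum.cong refl) (simp add: b)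
  finally show ?thesis .
qed

lemma laplacian_row:
  assumes "u \<in> verts G"
  shows "(\<Sum>v\<in>verts G. laplacian G w u v * y v) = form w (\<lambda>v. if v = u then 1 else 0) y"
proof -
  let ?f = "\<lambda>v. if v = u then 1 else 0 :: real"
  have "form w ?f y = (\<Sum>u'\<in>verts G. ?f u' * (\<Sum>v\<in>verts G. laplacian G w u' v * y v))"
    unfolding laplacian_form[symmetric] by (simp add: sum_distrib_left mult.assoc)
  also have "\<dots> = (\<Sum>u'\<in>verts G. if u' = u then (\<Sum>v\<in>verts G. laplacian G w u' v * y v) else 0)"
    by (intro sum.cong) auto
  finally show ?thesis using assms finite_verts by simp
qed

lemma form_zero_iff_rows:
  "(\<forall>x. form w x y = 0) \<longleftrightarrow>
     (\<forall>u\<in>verts G. form w (\<lambda>v. if v = u then 1 else 0) y = 0)" (is "?L \<longleftrightarrow> ?R")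
proof
  assume R: ?R
  have "form w x y = (\<Sum>u\<in>verts G. x u * (\<Sum>v\<in>verts G. laplacian G w u v * y v))" for x
    unfolding laplacian_form[symmetric] by (simp add: sum_distrib_left mult.assoc)
  then show ?L using R by (simp add: laplacian_row)
qed blast

lemma equilibrium_row:
  fixes p :: "'v \<Rightarrow> real ^ 'd"
  assumes i: "i \<in> verts G"
  shows "(\<Sum>j\<in>verts G. \<Sum>e\<in>{e \<in> edges G. ends G e = Upair i j}. w e *\<^sub>R (p j - p i)) $ k =
    - form w (\<lambda>v. if v = i then 1 else 0) (\<lambda>v. p v $ k)"
proof -
  let ?V = "verts G"
  have "(\<Sum>j\<in>?V. \<Sum>e\<in>{e \<in> edges G. ends G e = Upair i j}. w e *\<^sub>R (p j - p i)) $ k =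
      (\<Sum>j\<in>?V. \<Sum>e\<in>edges G. if ends G e = Upair i j then w e * (p j $ k - p i $ k) else 0)"
    using finite_edges by (auto simp: sum.inter_filter intro!: sum.cong)
  also have "\<dots> = (\<Sum>e\<in>edges G. \<Sum>j\<in>?V. if ends G e = Upair i j then w e * (p j $ k - p i $ k) else 0)"
    by (rule sum.swap)
  also have "\<dots> = (\<Sum>e\<in>edges G. - (w e * ((if s e = i then 1 else 0) - (if t e = i then 1 else 0))
      * (p (s e) $ k - p (t e) $ k)))"
  proof (rule sum.cong[OF refl])
    fix e assume e: "e \<in> edges G"
    \<comment> \<open>An edge at \<open>i\<close> meets only one \<open>j\<close>, its other end.
      The two summands are the cases \<open>s e = i\<close> and \<open>t e = i\<close>, which
      exclude each other because there are no loops.\<close>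
    have "(\<Sum>j\<in>?V. if ends G e = Upair i j then w e * (p j $ k - p i $ k) else 0) =
        (\<Sum>j\<in>?V. (if j = t e then (if s e = i then w e * (p j $ k - p i $ k) else 0) else 0) +
          (if j = s e then (if t e = i then w e * (p j $ k - p i $ k) else 0) else 0))"
      by (intro sum.cong refl) (use ends_neq[OF e] orient[OF e] in auto)
    also have "\<dots> = - (w e * ((if s e = i then 1 else 0) - (if t e = i then 1 else 0))
      * (p (s e) $ k - p (t e) $ k))"
      using finite_verts ends_verts[OF e] ends_neq[OF e]
      by (auto simp: sum.distrib algebra_simps)
    finally show "(\<Sum>j\<in>?V. if ends G e = Upair i j then w e * (p j $ k - p i $ k) else 0) = \<dots>" .
  qed
  finally show ?thesis by (simp add: edge_form_def sum_negf)
qed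

text \<open>Equilibrium means that every coordinate function of \<open>p\<close> lies in the kernel
  of the Laplacian; arbitrary test functions \<open>x\<close> are combinations of the indicator
  functions of vertices.\<close>

lemma equilibrium_iff:
  fixes p :: "'v \<Rightarrow> real ^ 'd"
  shows "equilibrium_stress G p w \<longleftrightarrow> (\<forall>k x. form w x (\<lambda>v. p v $ k) = 0)"
proof -
  have "equilibrium_stress G p w \<longleftrightarrow>
      (\<forall>i\<in>verts G. \<forall>k. form w (\<lambda>v. if v = i then 1 else 0) (\<lambda>v. p v $ k) = 0)"
    unfolding equilibrium_stress_def
    by (intro ball_cong refl) (simp only: vec_eq_iff equilibrium_row, simp)
  also have "\<dots> \<longleftrightarrow> (\<forall>k x. form w x (\<lambda>v. p v $ k) = 0)"
    unfolding form_zero_iff_rows by blast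
  finally show ?thesis .
qed

lemma form_cong:
  assumes "\<And>v. v \<in> verts G \<Longrightarrow> x v = x' v" "\<And>v. v \<in> verts G \<Longrightarrow> y v = y' v"
  shows "form w x y = form w x' y'"
  unfolding edge_form_def by (intro sum.cong refl) (simp add: assms ends_verts)

lemma laplacian_sym: "laplacian G w u v = laplacian G w v u"
  unfolding laplacian_def by (intro sum.cong refl) (simp add: orient edge_matrix_Upair)

lemma psd_iff: "psd_on (verts G) (laplacian G w) \<longleftrightarrow> (\<forall>x. form w x x \<ge> 0)"
proof
  assume psd: "psd_on (verts G) (laplacian G w)"
  show "\<forall>x. form w x x \<ge> 0"
  proof
    fix x :: "'v \<Rightarrow> real"
    obtain q where q: "Poly_Mapping.keys q \<subseteq> verts G" "\<forall>v\<in>verts G. poly_mapping.lookup q v = x v"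
      using poly_mapping_of_fun[OF finite_verts, of x] by blast
    have "form w (poly_mapping.lookup q) (poly_mapping.lookup q) \<ge> 0"
      using psd q(1) by (simp add: psd_on_def laplacian_form)
    then show "form w x x \<ge> 0" using form_cong[of "poly_mapping.lookup q" x] q(2) by simp
  qed
next
  assume "\<forall>x. form w x x \<ge> 0"
  then show "psd_on (verts G) (laplacian G w)"
    by (simp add: psd_on_def laplacian_form) (meson laplacian_sym)
qed

lemma kernel_eq: "kernel_on (verts G) (laplacian G w) =
  {q. Poly_Mapping.keys q \<subseteq> verts G \<and> (\<forall>x. form w x (poly_mapping.lookup q) = 0)}"
  unfolding kernel_on_def form_zero_iff_rows by (auto simp: laplacian_row)

text \<open>The affine functions of \<open>p\<close> always lie in the kernel, and they form a space
  of dimension d + 1 because the points span affinely. The dimension condition thus says that the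
  kernel contains nothing else.\<close>

lemma kernel_dim_iff:
  fixes p :: "'v \<Rightarrow> real ^ 'd"
  assumes hull: "affine hull (p ` verts G) = UNIV"
    and stress: "\<And>k x. form w x (\<lambda>v. p v $ k) = 0"
  shows "dim (kernel_on (verts G) (laplacian G w)) = CARD('d) + 1 \<longleftrightarrow>
    (\<forall>y. (\<forall>x. form w x y = 0) \<longrightarrow> (\<exists>a b. \<forall>v\<in>verts G. y v = b + a \<bullet> p v))"
proof -
  let ?K = "kernel_on (verts G) (laplacian G w)"
  \<comment> \<open>\<open>f (a, b)\<close> is the finitely supported copy of the affine function
    with gradient \<open>a\<close> and constant \<open>b\<close>; its domain has dimension d +
    1.\<close>
  define f :: "(real ^ 'd) \<times> real \<Rightarrow> 'v \<Rightarrow>\<^sub>0 real" where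
    "f c = (SOME q. Poly_Mapping.keys q \<subseteq> verts G \<and>
       (\<forall>v\<in>verts G. poly_mapping.lookup q v = snd c + fst c \<bullet> p v))" for c
  have f: "Poly_Mapping.keys (f c) \<subseteq> verts G"
      "v \<in> verts G \<Longrightarrow> poly_mapping.lookup (f c) v = snd c + fst c \<bullet> p v" for c v
    using someI_ex[OF poly_mapping_of_fun[OF finite_verts, of "\<lambda>v. snd c + fst c \<bullet> p v"]]
    unfolding f_def by blast+
  have ext: "q = q'" if "Poly_Mapping.keys q \<subseteq> verts G" "Poly_Mapping.keys q' \<subseteq> verts G"
    "\<And>v. v \<in> verts G \<Longrightarrow> poly_mapping.lookup q v = poly_mapping.lookup q' v" for q q' :: "'v \<Rightarrow>\<^sub>0 real"
  proof (rule poly_mapping_eqI)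
    show "poly_mapping.lookup q v = poly_mapping.lookup q' v" for v
      using that by (cases "v \<in> verts G") (auto, metis in_keys_iff subsetD)
  qed
  have lin: "linear f"
  proof (rule linearI)
    show "f (c + c') = f c + f c'" for c c'
    proof (rule ext)
      show "Poly_Mapping.keys (f c + f c') \<subseteq> verts G"
        using f(1)[of c] f(1)[of c'] keys_add[of "f c" "f c'"] by blast
    qed (use f in \<open>auto simp: lookup_add inner_add_left\<close>)
    show "f (r *\<^sub>R c) = r *\<^sub>R f c" for r c
    proof (rule ext)
      show "Poly_Mapping.keys (r *\<^sub>R f c) \<subseteq> verts G"
        using f(1)[of c] by (auto simp: in_keys_iff lookup_scaleR)
    qed (use f in \<open>auto simp: lookup_scaleR algebra_simps\<close>)
  qed
  have inj: "inj f"
    unfolding linear_injective_0[OF lin]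
  proof (intro allI impI)
    fix c assume "f c = 0"
    then have "snd c + fst c \<bullet> p v = 0" if "v \<in> verts G" for v using f(2)[OF that, of c] by simp
    then have "fst c = 0 \<and> snd c = 0" by (intro affine_functional_zero[OF hull]) auto
    then show "c = 0" by (simp add: prod_eq_iff)
  qed
  have fK: "range f \<subseteq> ?K"
  proof -
    have "form w x (poly_mapping.lookup (f c)) = 0" for x c
      using edge_form_affine[OF stress, of x "snd c" "fst c"] form_cong[of x x "poly_mapping.lookup (f c)"] f(2)
      by simp
    then show ?thesis using f(1) unfolding kernel_eq by blast
  qed
  obtain B :: "((real ^ 'd) \<times> real) set" where B: "independent B" "span B = UNIV" "card B = CARD('d) + 1"
    using basis_exists[of "UNIV :: ((real ^ 'd) \<times> real) set"] by (auto simp: top.extremum_unique)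
  have indf: "independent (f ` B)"
    using B(1) inj lin linear_independent_injective_image inj_on_subset[of f UNIV] by blast
  have cardf: "card (f ` B) = CARD('d) + 1"
    using B(3) inj by (metis card_image inj_on_subset subset_UNIV)
  have spanf: "span (f ` B) = range f"
    using B(2) lin by (metis linear_span_image)
  have "dim ?K = CARD('d) + 1 \<longleftrightarrow> ?K = range f"
  proof
    assume K: "dim ?K = CARD('d) + 1"
    have fB: "f ` B \<subseteq> ?K" using fK by blast
    \<comment> \<open>A basis of the kernel that extends the image of \<open>B\<close>; equal
      cardinalities leave no room for new vectors.\<close>
    obtain C where C: "f ` B \<subseteq> C" "C \<subseteq> ?K" "independent C" "?K \<subseteq> span C"
      by (rule maximal_independent_subset_extend[OF fB indf])
    have "card C = CARD('d) + 1" using dim_eq_card[OF _ C(3), of ?K] C K span_mono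
      by (metis basis_card_eq_dim)
    then have "f ` B = C"
      using C(1) cardf by (metis card.infinite card_subset_eq nat.distinct(1) add.commute plus_1_eq_Suc)
    then show "?K = range f" using C spanf fK by blast
  next
    assume "?K = range f"
    then show "dim ?K = CARD('d) + 1"
      using dim_eq_card[of "f ` B" ?K] spanf indf cardf by (metis span_span)
  qed
  also have "\<dots> \<longleftrightarrow> (\<forall>y. (\<forall>x. form w x y = 0) \<longrightarrow> (\<exists>a b. \<forall>v\<in>verts G. y v = b + a \<bullet> p v))"
  proof (intro iffI allI impI)
    fix y assume K: "?K = range f" and y: "\<forall>x. form w x y = 0"
    obtain q where q: "Poly_Mapping.keys q \<subseteq> verts G" "\<forall>v\<in>verts G. poly_mapping.lookup q v = y v"
      using poly_mapping_of_fun[OF finite_verts, of y] by blast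
    have "form w x (poly_mapping.lookup q) = 0" for x
      using form_cong[of x x "poly_mapping.lookup q" y] y q(2) by simp
    then have "q \<in> range f" using K q by (auto simp: kernel_eq)
    then obtain c where "q = f c" by blast
    then show "\<exists>a b. \<forall>v\<in>verts G. y v = b + a \<bullet> p v" using f(2)[of _ c] q(2) by metis
  next
    assume R: "\<forall>y. (\<forall>x. form w x y = 0) \<longrightarrow> (\<exists>a b. \<forall>v\<in>verts G. y v = b + a \<bullet> p v)"
    have "q \<in> range f" if q: "q \<in> ?K" for q
    proof -
      obtain a b where "\<forall>v\<in>verts G. poly_mapping.lookup q v = b + a \<bullet> p v"
        using R[rule_format, of "poly_mapping.lookup q"] q unfolding kernel_eq by blast
      then have "q = f (a, b)"
        using q f by (intro ext) (auto simp: kernel_eq)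
      then show ?thesis by blast
    qed
    then show "?K = range f" using fK by blast
  qed
  finally show ?thesis .
qed

lemma super_stable_iff:
  fixes p :: "'v \<Rightarrow> real ^ 'd"
  shows "super_stable G \<sigma> p \<longleftrightarrow> affine hull (p ` verts G) = UNIV \<and>
    (\<exists>w. (\<forall>k x. form w x (\<lambda>v. p v $ k) = 0) \<and> (\<forall>e\<in>edges G. sign_val (\<sigma> e) * w e > 0) \<and>
      (\<forall>x. form w x x \<ge> 0) \<and>
      (\<forall>y. (\<forall>x. form w x y = 0) \<longrightarrow> (\<exists>a b. \<forall>v\<in>verts G. y v = b + a \<bullet> p v))) \<and>
    (\<forall>S :: real ^ 'd ^ 'd. transpose S = S \<longrightarrow>
       (\<forall>e\<in>edges G. (p (s e) - p (t e)) \<bullet> (S *v (p (s e) - p (t e))) = 0) \<longrightarrow> S = 0)"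
proof -
  have "(\<forall>i j. ends G e = Upair i j \<longrightarrow> (p j - p i) \<bullet> (S *v (p j - p i)) = 0) \<longleftrightarrow>
      (p (s e) - p (t e)) \<bullet> (S *v (p (s e) - p (t e))) = 0" if "e \<in> edges G" for S :: "real ^ 'd ^ 'd" and e
  proof -
    \<comment> \<open>A quadratic form is even, so one orientation of each edge suffices.\<close>
    have "(p j - p i) \<bullet> (S *v (p j - p i)) = (p i - p j) \<bullet> (S *v (p i - p j))" for i j
      by (simp add: matrix_vector_mult_diff_distrib inner_diff_left inner_diff_right)
    then show ?thesis using orient[OF that] by auto
  qed
  then have rigid: "(\<not> (\<exists>S :: real ^ 'd ^ 'd. S \<noteq> 0 \<and> transpose S = S \<and>
          (\<forall>e\<in>edges G. \<forall>i j. ends G e = Upair i j \<longrightarrow> (p j - p i) \<bullet> (S *v (p j - p i)) = 0))) \<longleftrightarrow>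
    (\<forall>S :: real ^ 'd ^ 'd. transpose S = S \<longrightarrow>
       (\<forall>e\<in>edges G. (p (s e) - p (t e)) \<bullet> (S *v (p (s e) - p (t e))) = 0) \<longrightarrow> S = 0)"
    by (simp cong: ball_cong) blast
  show ?thesis
    unfolding super_stable_def rigid equilibrium_iff strictly_proper_def psd_iff
    by (intro conj_cong ex_cong1 refl kernel_dim_iff) auto
qed

end

section \<open>Symmetric bilinear forms\<close>

lemma square_add_le: "(a + b)\<^sup>2 \<le> 2 * a\<^sup>2 + 2 * b\<^sup>2" for a b :: real
  using sum_squares_bound[of a b] by (simp add: power2_sum)

lemma edge_form_sym: "edge_form s t E w x y = edge_form s t E w y x"
  unfolding edge_form_def by (intro sum.cong) auto

lemma edge_form_add: "edge_form s t E w (\<lambda>v. x v + y v) z = edge_form s t E w x z + edge_form s t E w y z"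
  unfolding edge_form_def by (simp add: sum.distrib[symmetric] algebra_simps)

lemma edge_form_scale: "edge_form s t E w (\<lambda>v. c * x v) z = c * edge_form s t E w x z"
  unfolding edge_form_def by (simp add: sum_distrib_left algebra_simps)

text \<open>Serves both for the energy on a graph and for its pullback along the projection to
  representatives.\<close>

locale sym_bilinear_form =
  fixes B :: "('v \<Rightarrow> real) \<Rightarrow> ('v \<Rightarrow> real) \<Rightarrow> real"
  assumes sym: "B x y = B y x"
    and add: "B (\<lambda>v. x v + y v) z = B x z + B y z"
    and scale: "B (\<lambda>v. c * x v) z = c * B x z"
begin

lemma add_right: "B z (\<lambda>v. x v + y v) = B z x + B z y"
  by (metis sym add)

lemma scale_right: "B z (\<lambda>v. c * x v) = c * B z x"
  by (metis sym scale)

lemma diff: "B (\<lambda>v. x v - y v) z = B x z - B y z"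
  using add[of x "\<lambda>v. (-1) * y v" z] scale[of "-1" y z] by simp

lemma diff_right: "B z (\<lambda>v. x v - y v) = B z x - B z y"
  by (metis sym diff)

lemma zero: "B (\<lambda>v. 0) z = 0"
  using scale[of 0] by simp

lemma square_add: "B (\<lambda>v. x v + y v) (\<lambda>v. x v + y v) = B x x + 2 * B x y + B y y"
  by (simp add: add add_right sym)

text \<open>Adding a multiple of the isotropic \<open>y\<close> changes the energy of
  \<open>x\<close> by a linear function of the multiplier, which cannot be bounded below unless its
  slope is zero.\<close>

lemma psd_isotropic:
  assumes psd: "\<And>x. B x x \<ge> 0" and y: "B y y = 0"
  shows "B x y = 0"
proof (rule ccontr)
  assume n: "B x y \<noteq> 0"
  have "B (\<lambda>v. x v + c * y v) (\<lambda>v. x v + c * y v) = B x x + 2 * c * B x y" for c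
    by (simp add: square_add scale scale_right y)
  then have "0 \<le> B x x + 2 * c * B x y" for c using psd by metis
  \<comment> \<open>This multiplier makes the energy equal to -1.\<close>
  from this[of "- (B x x + 1) / (2 * B x y)"] show False using n by (simp add: field_simps)
qed

text \<open>Gaussian elimination of one variable at a time.\<close>

lemma harmonic_extension:
  assumes "finite A"
    and "\<And>z. (\<And>v. v \<notin> A \<Longrightarrow> z v = 0) \<Longrightarrow> (\<exists>v. z v \<noteq> 0) \<Longrightarrow> B z z > 0"
  shows "\<exists>z. (\<forall>v. v \<notin> A \<longrightarrow> z v = 0) \<and>
    (\<forall>y. (\<forall>v. v \<notin> A \<longrightarrow> y v = 0) \<longrightarrow> B (\<lambda>v. g v + z v) y = 0)"
  using assms
proof (induction A arbitrary: g rule: finite_induct)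
  case empty
  have "B g y = 0" if "\<forall>v. y v = 0" for y
  proof -
    have "y = (\<lambda>v. 0)" using that by auto
    then show ?thesis by (metis sym zero)
  qed
  then show ?case by (intro exI[of _ "\<lambda>v. 0"]) auto
next
  case (insert v\<^sub>0 A)
  have pos: "B z z > 0" if "\<And>v. v \<notin> A \<Longrightarrow> z v = 0" "\<exists>v. z v \<noteq> 0" for z
    using insert.prems that by blast
  define \<delta> where "\<delta> v = (if v = v\<^sub>0 then 1 else 0 :: real)" for v
  obtain z' where z': "\<forall>v. v \<notin> A \<longrightarrow> z' v = 0"
      "\<forall>y. (\<forall>v. v \<notin> A \<longrightarrow> y v = 0) \<longrightarrow> B (\<lambda>v. \<delta> v + z' v) y = 0"
    using insert.IH[of \<delta>, OF pos] by blast
  obtain z where z: "\<forall>v. v \<notin> A \<longrightarrow> z v = 0"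
      "\<forall>y. (\<forall>v. v \<notin> A \<longrightarrow> y v = 0) \<longrightarrow> B (\<lambda>v. g v + z v) y = 0"
    using insert.IH[of g, OF pos] by blast
  \<comment> \<open>The indicator of \<open>v\<^sub>0\<close>, corrected to be
    \<open>B\<close>-orthogonal to all functions supported in \<open>A\<close>; it carries the new
    variable.\<close>
  define e where "e = (\<lambda>v. \<delta> v + z' v)"
  have e: "e v\<^sub>0 = 1" "\<And>v. v \<notin> insert v\<^sub>0 A \<Longrightarrow> e v = 0"
    using z'(1) insert.hyps by (auto simp: e_def \<delta>_def)
  have ee: "B e e > 0" using insert.prems[of e] e by (metis zero_neq_one)
  \<comment> \<open>The coefficient of the orthogonal projection to \<open>e\<close>. Subtracting it
    makes the result orthogonal to \<open>e\<close> and keeps it orthogonal to the functions on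
    \<open>A\<close>.\<close>
  define k where "k = B (\<lambda>v. g v + z v) e / B e e"
  define z1 where "z1 = (\<lambda>v. z v - k * e v)"
  have "B (\<lambda>v. g v + z1 v) y = 0" if y: "\<forall>v. v \<notin> insert v\<^sub>0 A \<longrightarrow> y v = 0" for y
  proof -
    define y' where "y' = (\<lambda>v. y v - y v\<^sub>0 * e v)"
    have "y' v = 0" if "v \<notin> A" for v
      using y e that by (cases "v = v\<^sub>0") (auto simp: y'_def)
    then have y': "\<forall>v. v \<notin> A \<longrightarrow> y' v = 0" by blast
    have yy: "y = (\<lambda>v. y v\<^sub>0 * e v + y' v)" by (simp add: y'_def)
    have g1: "(\<lambda>v. g v + z1 v) = (\<lambda>v. (g v + z v) - k * e v)" by (auto simp: z1_def)
    have "B (\<lambda>v. g v + z1 v) y = y v\<^sub>0 * B (\<lambda>v. g v + z1 v) e + B (\<lambda>v. g v + z1 v) y'"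
      by (subst yy) (simp add: add_right scale_right)
    moreover have "B (\<lambda>v. g v + z1 v) y' = 0"
      using z(2) z'(2) y' unfolding g1 diff scale by (simp add: e_def)
    moreover have "B (\<lambda>v. g v + z1 v) e = 0"
      using ee unfolding g1 diff scale by (simp add: k_def)
    ultimately show ?thesis by simp
  qed
  moreover have "\<forall>v. v \<notin> insert v\<^sub>0 A \<longrightarrow> z1 v = 0" using z(1) e by (simp add: z1_def)
  ultimately show ?case by blast
qed

text \<open>The same elimination replaces compactness of the unit sphere: with \<open>e\<close>
  orthogonal to the functions on \<open>A\<close>, the energy of z is a multiple of the energy of
  \<open>e\<close> plus the energy of a function on \<open>A\<close>.\<close>

lemma coercive:
  assumes "finite A"
    and "\<And>z. (\<And>v. v \<notin> A \<Longrightarrow> z v = 0) \<Longrightarrow> (\<exists>v. z v \<noteq> 0) \<Longrightarrow> B z z > 0"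
  shows "\<exists>\<delta>>0. \<forall>z. (\<forall>v. v \<notin> A \<longrightarrow> z v = 0) \<longrightarrow> \<delta> * (\<Sum>v\<in>A. (z v)\<^sup>2) \<le> B z z"
  using assms
proof (induction A rule: finite_induct)
  case empty
  have "B z z = 0" if "\<forall>v. z v = 0" for z
  proof -
    have "z = (\<lambda>v. 0)" using that by auto
    then show ?thesis by (metis zero)
  qed
  then show ?case by (intro exI[of _ 1]) auto
next
  case (insert v\<^sub>0 A)
  have pos: "B z z > 0" if "\<And>v. v \<notin> A \<Longrightarrow> z v = 0" "\<exists>v. z v \<noteq> 0" for z
    using insert.prems that by blast
  obtain d where d: "d > 0" "\<And>z. (\<forall>v. v \<notin> A \<longrightarrow> z v = 0) \<Longrightarrow> d * (\<Sum>v\<in>A. (z v)\<^sup>2) \<le> B z z"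
    using insert.IH[OF pos] by blast
  define \<delta> where "\<delta> v = (if v = v\<^sub>0 then 1 else 0 :: real)" for v
  obtain z' where z': "\<forall>v. v \<notin> A \<longrightarrow> z' v = 0"
      "\<forall>y. (\<forall>v. v \<notin> A \<longrightarrow> y v = 0) \<longrightarrow> B (\<lambda>v. \<delta> v + z' v) y = 0"
    using harmonic_extension[OF insert.hyps(1), of \<delta>, OF pos] by blast
  define e where "e = (\<lambda>v. \<delta> v + z' v)"
  have e: "e v\<^sub>0 = 1" "\<And>v. v \<notin> insert v\<^sub>0 A \<Longrightarrow> e v = 0"
    using z'(1) insert.hyps by (auto simp: e_def \<delta>_def)
  have ee: "B e e > 0" using insert.prems[of e] e by (metis zero_neq_one)
  define N where "N = 1 + (\<Sum>v\<in>insert v\<^sub>0 A. (e v)\<^sup>2)"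
  have N: "N > 0" unfolding N_def by (intro add_pos_nonneg sum_nonneg) auto
  \<comment> \<open>Each orthogonal part of z pays for its own squares; the factors 2 come from
    \<open>square_add_le\<close>.\<close>
  define D where "D = min (B e e / (2 * N)) (d / 2)"
  have D: "D > 0" "D * (2 * N) \<le> B e e" "2 * D \<le> d"
    using ee N d by (auto simp: D_def min_def field_simps)
  have "D * (\<Sum>v\<in>insert v\<^sub>0 A. (z v)\<^sup>2) \<le> B z z" if z: "\<forall>v. v \<notin> insert v\<^sub>0 A \<longrightarrow> z v = 0" for z
  proof -
    define y where "y = (\<lambda>v. z v - z v\<^sub>0 * e v)"
    have "y v = 0" if "v \<notin> A" for v
      using z e that by (cases "v = v\<^sub>0") (auto simp: y_def)
    then have y: "\<forall>v. v \<notin> A \<longrightarrow> y v = 0" by blast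
    have zy: "z = (\<lambda>v. z v\<^sub>0 * e v + y v)" by (simp add: y_def)
    have Bzz: "B z z = (z v\<^sub>0)\<^sup>2 * B e e + B y y"
      using z'(2) y by (subst zy, subst (2) zy)
        (simp add: square_add scale scale_right power2_eq_square e_def[symmetric])
    have "(z v)\<^sup>2 \<le> 2 * ((z v\<^sub>0)\<^sup>2 * (e v)\<^sup>2) + 2 * (y v)\<^sup>2" for v
      using square_add_le[of "z v\<^sub>0 * e v" "y v"] by (simp add: y_def power_mult_distrib)
    then have "(\<Sum>v\<in>insert v\<^sub>0 A. (z v)\<^sup>2) \<le> (\<Sum>v\<in>insert v\<^sub>0 A. 2 * ((z v\<^sub>0)\<^sup>2 * (e v)\<^sup>2) + 2 * (y v)\<^sup>2)"
      by (intro sum_mono)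
    then have "(\<Sum>v\<in>insert v\<^sub>0 A. (z v)\<^sup>2) \<le> 2 * (z v\<^sub>0)\<^sup>2 * (N - 1) + 2 * (\<Sum>v\<in>insert v\<^sub>0 A. (y v)\<^sup>2)"
      by (simp only: N_def sum.distrib sum_distrib_left[symmetric]) (simp add: mult.assoc)
    then have "(\<Sum>v\<in>insert v\<^sub>0 A. (z v)\<^sup>2) \<le> 2 * (z v\<^sub>0)\<^sup>2 * N + 2 * (\<Sum>v\<in>A. (y v)\<^sup>2)"
      using insert.hyps y by (simp add: right_diff_distrib) (smt (verit) zero_le_power2)
    then have "D * (\<Sum>v\<in>insert v\<^sub>0 A. (z v)\<^sup>2) \<le> D * (2 * (z v\<^sub>0)\<^sup>2 * N + 2 * (\<Sum>v\<in>A. (y v)\<^sup>2))"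
      using D(1) by (simp add: mult_left_mono del: sum.insert)
    also have "\<dots> = (z v\<^sub>0)\<^sup>2 * (D * (2 * N)) + (2 * D) * (\<Sum>v\<in>A. (y v)\<^sup>2)"
      by (simp add: algebra_simps)
    also have "\<dots> \<le> (z v\<^sub>0)\<^sup>2 * B e e + d * (\<Sum>v\<in>A. (y v)\<^sup>2)"
      using D by (intro add_mono mult_left_mono mult_right_mono sum_nonneg) auto
    also have "\<dots> \<le> (z v\<^sub>0)\<^sup>2 * B e e + B y y" using d(2)[OF y] by simp
    finally show ?thesis using Bzz by simp
  qed
  then show ?case using D(1) by blast
qed

end

lemma edge_form_bilinear: "sym_bilinear_form (edge_form s t E w)"
  by unfold_locales (auto intro: edge_form_sym edge_form_add edge_form_scale)

lemma edge_form_pullback_bilinear: "sym_bilinear_form (\<lambda>x y. edge_form s t E w (x \<circ> r) (y \<circ> r))"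
  by unfold_locales (auto intro: edge_form_sym simp: comp_def edge_form_add edge_form_scale)

text \<open>An affine basis can be chosen among the points. Taking one representative vertex for
  each basis point makes all values on the chosen vertices interpolable by an affine function of the
  position, even if \<open>p\<close> is not injective.\<close>

lemma affine_base_vertices:
  fixes p :: "'v \<Rightarrow> real ^ 'd"
  assumes hull: "affine hull (p ` V) = UNIV"
    and r: "\<And>v. v \<in> V \<Longrightarrow> r v \<in> V" "\<And>v. v \<in> V \<Longrightarrow> r (r v) = r v" "\<And>v. v \<in> V \<Longrightarrow> p (r v) = p v"
  shows "\<exists>B\<subseteq>V. (\<forall>v\<in>B. r v = v) \<and> affine hull (p ` B) = UNIV \<and>
    (\<forall>x :: 'v \<Rightarrow> real. \<exists>a b. \<forall>v\<in>B. x v = b + a \<bullet> p v)"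
proof -
  obtain Q where Q: "Q \<subseteq> p ` V" "\<not> affine_dependent Q" "affine hull Q = UNIV"
    using affine_basis_exists[of "p ` V"] hull by auto
  have "\<forall>q\<in>Q. \<exists>v\<in>V. p v = q" using Q(1) by blast
  then obtain g where g: "\<And>q. q \<in> Q \<Longrightarrow> g q \<in> V" "\<And>q. q \<in> Q \<Longrightarrow> p (g q) = q" by metis
  let ?B = "(\<lambda>q. r (g q)) ` Q"
  have "p ` ?B = Q" using g r by (force simp: image_image)
  moreover have "\<exists>a b. \<forall>v\<in>?B. x v = b + a \<bullet> p v" for x :: "'v \<Rightarrow> real"
  proof -
    obtain q0 where q0: "q0 \<in> Q" using Q(3) by fastforce
    let ?h = "\<lambda>q. x (r (g q))"
    \<comment> \<open>With \<open>q0\<close> moved to the origin, the prescribed differences define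
      a linear functional on independent vectors; \<open>a\<close> will be its gradient.\<close>
    have "independent ((\<lambda>q. - q0 + q) ` (Q - {q0}))"
      using Q(2) affine_dependent_iff_dependent2[OF q0] by blast
    then obtain l where l: "linear l"
        "\<And>q. q \<in> (\<lambda>q. - q0 + q) ` (Q - {q0}) \<Longrightarrow> l q = ?h (q0 + q) - ?h q0"
      using linear_independent_extend[of _ "\<lambda>q. ?h (q0 + q) - ?h q0"] by blast
    define a where "a = adjoint l 1"
    have a: "l q = a \<bullet> q" for q
      using adjoint_works[OF l(1), of q 1] by (simp add: a_def inner_commute)
    have h: "?h q = ?h q0 + a \<bullet> (q - q0)" if "q \<in> Q" for q
      using l(2)[of "- q0 + q"] that a by (cases "q = q0") (auto simp: algebra_simps)
    have "x v = (?h q0 - a \<bullet> q0) + a \<bullet> p v" if "v \<in> ?B" for v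
      using that h g r by (auto simp: inner_diff_right)
    then show ?thesis by blast
  qed
  ultimately show ?thesis
    using Q(3) g r by (intro exI[of _ ?B]) auto
qed

section \<open>Weights near the contracted limit\<close>

lemma abs_edge_form_le:
  fixes \<kappa> X Y :: real
  assumes "\<And>e. e \<in> F \<Longrightarrow> \<bar>c e\<bar> \<le> \<kappa>" "0 \<le> X" "0 \<le> Y"
    and "\<And>e. e \<in> F \<Longrightarrow> \<bar>x (s e) - x (t e)\<bar> \<le> X" "\<And>e. e \<in> F \<Longrightarrow> \<bar>y (s e) - y (t e)\<bar> \<le> Y"
  shows "\<bar>edge_form s t F c x y\<bar> \<le> card F * (\<kappa> * X * Y)"
proof -
  have "\<bar>edge_form s t F c x y\<bar> \<le> (\<Sum>e\<in>F. \<bar>c e * (x (s e) - x (t e)) * (y (s e) - y (t e))\<bar>)"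
    unfolding edge_form_def by (rule sum_abs)
  also have "\<dots> \<le> (\<Sum>e\<in>F. \<kappa> * X * Y)"
    unfolding abs_mult
  proof (intro sum_mono mult_mono)
    show "0 \<le> \<kappa> * X" if "e \<in> F" for e using assms(1)[OF that] assms(2) by simp
  qed (use assms in \<open>auto intro: order_trans[OF abs_ge_zero]\<close>)
  finally show ?thesis by simp
qed

text \<open>The quotient is encoded inside \<open>V\<close>: \<open>r v\<close> is a chosen representative of the fibre of \<open>v\<close>, functions
  on the quotient are the functions \<open>x \<circ> r\<close>, and \<open>M\<close> is the image in \<open>E\<close> of the edges of the minor.
  \<open>B\<close> carries an affine basis of the points; these vertices stay pinned.\<close>

locale contraction =
  fixes V :: "'v set" and E M :: "'e set" and s t :: "'e \<Rightarrow> 'v" and r :: "'v \<Rightarrow> 'v"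
    and \<omega> :: "'e \<Rightarrow> real" and p :: "'v \<Rightarrow> real ^ 'd" and B :: "'v set"
  assumes finite_V: "finite V" and finite_E: "finite E"
    and ends_V: "e \<in> E \<Longrightarrow> s e \<in> V" "e \<in> E \<Longrightarrow> t e \<in> V"
    and M_E: "M \<subseteq> E" and M_outer: "e \<in> M \<Longrightarrow> r (s e) \<noteq> r (t e)"
    and r_V: "v \<in> V \<Longrightarrow> r v \<in> V" and r_r: "v \<in> V \<Longrightarrow> r (r v) = r v"
    and p_r: "v \<in> V \<Longrightarrow> p (r v) = p v"
    and linked: "v \<in> V \<Longrightarrow>
      (v, r v) \<in> {(a, b). \<exists>e\<in>E. r (s e) = r (t e) \<and> (a = s e \<and> b = t e \<or> a = t e \<and> b = s e)}\<^sup>*"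
    and \<omega>_nonzero: "e \<in> M \<Longrightarrow> \<omega> e \<noteq> 0"
    and stress: "edge_form s t M \<omega> (x \<circ> r) (\<lambda>v. p v $ k) = 0"
    and psd: "edge_form s t M \<omega> (x \<circ> r) (x \<circ> r) \<ge> 0"
    and isotropic: "edge_form s t M \<omega> (x \<circ> r) (x \<circ> r) = 0 \<Longrightarrow> \<exists>a b. \<forall>v\<in>V. x (r v) = b + a \<bullet> p v"
    and rigid: "\<And>S :: real ^ 'd ^ 'd. transpose S = S \<Longrightarrow>
      (\<And>e. e \<in> M \<Longrightarrow> (p (s e) - p (t e)) \<bullet> (S *v (p (s e) - p (t e))) = 0) \<Longrightarrow> S = 0"
    and B_V: "B \<subseteq> V" and r_B: "v \<in> B \<Longrightarrow> r v = v"
    and hull_B: "affine hull (p ` B) = UNIV"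
    and interpolation: "\<exists>a b. \<forall>v\<in>B. x v = b + a \<bullet> p v"
begin

section \<open>Edge classes and coercivity of the weighted energy\<close>

definition inner_edges :: "'e set" where "inner_edges = {e \<in> E. r (s e) = r (t e)}"
definition other_edges :: "'e set" where "other_edges = {e \<in> E. r (s e) \<noteq> r (t e) \<and> e \<notin> M}"

text \<open>The other edges get a positive weight and not 0, because a strictly proper stress must
  not vanish on any edge.\<close>

definition weight :: "real \<Rightarrow> ('e \<Rightarrow> real) \<Rightarrow> 'e \<Rightarrow> real" where
  "weight \<epsilon> c e = (if r (s e) = r (t e) then 1 / \<epsilon> else if e \<in> M then \<omega> e + c e else \<epsilon>)"

abbreviation "size_V x \<equiv> L2_set x V"
abbreviation "size_I x \<equiv> L2_set (\<lambda>e. x (s e) - x (t e)) inner_edges"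
abbreviation "form \<equiv> edge_form s t"

lemma M_disjoint: "E = inner_edges \<union> M \<union> other_edges" "inner_edges \<inter> M = {}"
    "(inner_edges \<union> M) \<inter> other_edges = {}"
  using M_E M_outer by (auto simp: inner_edges_def other_edges_def)

lemma finite_parts: "finite inner_edges" "finite M" "finite other_edges"
  using finite_E M_E finite_subset by (auto simp: inner_edges_def other_edges_def)

lemma parts_subset: "inner_edges \<subseteq> E" "M \<subseteq> E" "other_edges \<subseteq> E"
  using M_E by (auto simp: inner_edges_def other_edges_def)

lemma form_weight: "form E (weight \<epsilon> c) x y =
    1 / \<epsilon> * form inner_edges (\<lambda>_. 1) x y + form M \<omega> x y + form M c x y + \<epsilon> * form other_edges (\<lambda>_. 1) x y"
proof -
  have "form E (weight \<epsilon> c) x y = form inner_edges (weight \<epsilon> c) x y + form M (weight \<epsilon> c) x y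
      + form other_edges (weight \<epsilon> c) x y"
    unfolding edge_form_def
    by (subst M_disjoint(1), subst sum.union_disjoint, use finite_parts M_disjoint in simp,
        use finite_parts in simp, use M_disjoint in simp,
        subst sum.union_disjoint) (use finite_parts M_disjoint in simp_all)
  moreover have "form inner_edges (weight \<epsilon> c) x y = 1 / \<epsilon> * form inner_edges (\<lambda>_. 1) x y"
    unfolding edge_form_def sum_distrib_left
    by (intro sum.cong) (auto simp: weight_def inner_edges_def)
  moreover have "form other_edges (weight \<epsilon> c) x y = \<epsilon> * form other_edges (\<lambda>_. 1) x y"
    unfolding edge_form_def sum_distrib_left
    by (intro sum.cong) (auto simp: weight_def other_edges_def)
  moreover have "form M (weight \<epsilon> c) x y = form M \<omega> x y + form M c x y"
    unfolding edge_form_def sum.distrib[symmetric]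
    by (intro sum.cong) (use M_outer in \<open>auto simp: weight_def algebra_simps\<close>)
  ultimately show ?thesis by simp
qed

lemma abs_le_size_V: "v \<in> V \<Longrightarrow> \<bar>x v\<bar> \<le> size_V x"
  using member_le_L2_set[OF finite_V, of v "\<lambda>v. \<bar>x v\<bar>"] by (simp add: L2_set_def)

lemma diff_le_size_V:
  assumes "e \<in> E"
  shows "\<bar>x (s e) - x (t e)\<bar> \<le> 2 * size_V x"
  using abs_le_size_V[OF ends_V(1)[OF assms], of x] abs_le_size_V[OF ends_V(2)[OF assms], of x] by linarith

lemma form_bound:
  fixes \<kappa> :: real
  assumes "F \<subseteq> E" "\<And>e. e \<in> F \<Longrightarrow> \<bar>c e\<bar> \<le> \<kappa>"
  shows "\<bar>form F c x y\<bar> \<le> 4 * real (card F) * \<kappa> * size_V x * size_V y"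
proof -
  have "\<bar>form F c x y\<bar> \<le> card F * (\<kappa> * (2 * size_V x) * (2 * size_V y))"
    by (rule abs_edge_form_le) (use assms diff_le_size_V in auto)
  then show ?thesis by (simp add: algebra_simps)
qed

lemma form_inner: "form inner_edges (\<lambda>_. 1) x x = (size_I x)\<^sup>2"
  unfolding edge_form_def L2_set_def by (simp add: sum_nonneg power2_eq_square)

lemma form_other_nonneg: "form other_edges (\<lambda>_. 1) x x \<ge> 0"
  unfolding edge_form_def by (intro sum_nonneg) (simp add: mult.assoc)

text \<open>A discrete Poincare inequality: on a path of inner edges from \<open>v\<close> to
  \<open>r v\<close> every step costs at most \<open>size_I x\<close>. The constant counts the steps
  of a path fixed before \<open>x\<close>.\<close>

lemma fibre_bound: "\<exists>C\<ge>0. \<forall>x. size_V (\<lambda>v. x v - x (r v)) \<le> C * size_I x"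
proof -
  let ?R = "{(a, b). \<exists>e\<in>E. r (s e) = r (t e) \<and> (a = s e \<and> b = t e \<or> a = t e \<and> b = s e)}"
  have step: "\<bar>x a - x b\<bar> \<le> size_I x" if ab: "(a, b) \<in> ?R" for a b x
  proof -
    obtain e where e: "e \<in> inner_edges" "\<bar>x a - x b\<bar> = \<bar>x (s e) - x (t e)\<bar>"
      using ab by (auto simp: inner_edges_def abs_minus_commute)
    then show ?thesis
      using member_le_L2_set[OF finite_parts(1) e(1), of "\<lambda>e. \<bar>x (s e) - x (t e)\<bar>"]
      by (simp add: L2_set_def)
  qed
  have path: "\<exists>k\<ge>0. \<forall>x. \<bar>x a - x b\<bar> \<le> k * size_I x" if "(a, b) \<in> ?R\<^sup>*" for a b
    using that
  proof (induction rule: rtrancl_induct)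
    case base
    show ?case by (intro exI[of _ 0]) auto
  next
    case (step b c)
    then obtain k where k: "k \<ge> 0" "\<And>x. \<bar>x a - x b\<bar> \<le> k * size_I x" by blast
    have "\<bar>x a - x c\<bar> \<le> (k + 1) * size_I x" for x
      using k(2)[of x] \<open>\<And>a b x. (a, b) \<in> ?R \<Longrightarrow> \<bar>x a - x b\<bar> \<le> size_I x\<close>[OF step.hyps(2), of x]
      by (simp add: algebra_simps)
    then show ?case using k(1) by (intro exI[of _ "k + 1"]) auto
  qed
  have "\<forall>v\<in>V. \<exists>k\<ge>0. \<forall>x. \<bar>x v - x (r v)\<bar> \<le> k * size_I x" using path[OF linked] by blast
  then obtain k where k: "\<And>v. v \<in> V \<Longrightarrow> k v \<ge> 0" "\<And>v x. v \<in> V \<Longrightarrow> \<bar>x v - x (r v)\<bar> \<le> k v * size_I x"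
    by metis
  have "size_V (\<lambda>v. x v - x (r v)) \<le> (\<Sum>v\<in>V. k v) * size_I x" for x
  proof -
    have "size_V (\<lambda>v. x v - x (r v)) \<le> (\<Sum>v\<in>V. \<bar>x v - x (r v)\<bar>)" by (rule L2_set_le_sum_abs)
    also have "\<dots> \<le> (\<Sum>v\<in>V. k v * size_I x)" using k(2) by (intro sum_mono) auto
    finally show ?thesis by (simp add: sum_distrib_right)
  qed
  then show ?thesis using k(1) by (intro exI[of _ "\<Sum>v\<in>V. k v"]) (auto intro: sum_nonneg)
qed

lemma form_cong_V:
  assumes "F \<subseteq> E" "\<And>v. v \<in> V \<Longrightarrow> x v = x' v" "\<And>v. v \<in> V \<Longrightarrow> y v = y' v"
  shows "form F c x y = form F c x' y'"
  unfolding edge_form_def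
proof (intro sum.cong refl)
  fix e assume "e \<in> F"
  then have "s e \<in> V" "t e \<in> V" using assms(1) ends_V by auto
  then show "c e * (x (s e) - x (t e)) * (y (s e) - y (t e)) = c e * (x' (s e) - x' (t e)) * (y' (s e) - y' (t e))"
    using assms by simp
qed

text \<open>A function on the quotient without energy is affine in \<open>p\<close>; if it also
  vanishes on \<open>B\<close>, it is zero, since the points of \<open>B\<close> span affinely.
  Positivity then turns into coercivity.\<close>

lemma coercive_quotient:
  "\<exists>\<delta>>0. \<forall>x. (\<forall>v\<in>B. x v = 0) \<longrightarrow> \<delta> * (size_V (\<lambda>v. x (r v)))\<^sup>2 \<le> form M \<omega> (x \<circ> r) (x \<circ> r)"
proof -
  interpret Q: sym_bilinear_form "\<lambda>x y. form M \<omega> (x \<circ> r) (y \<circ> r)"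
    by (rule edge_form_pullback_bilinear)
  let ?A = "r ` V - B"
  have fin: "finite ?A" using finite_V by blast
  have pos: "form M \<omega> (z \<circ> r) (z \<circ> r) > 0" if z: "\<And>v. v \<notin> ?A \<Longrightarrow> z v = 0" "\<exists>v. z v \<noteq> 0" for z
  proof (rule ccontr)
    assume "\<not> ?thesis"
    then have "form M \<omega> (z \<circ> r) (z \<circ> r) = 0" using psd[of z] by simp
    then obtain a b where ab: "\<And>v. v \<in> V \<Longrightarrow> z (r v) = b + a \<bullet> p v" using isotropic by blast
    have "b + a \<bullet> p v = 0" if "v \<in> B" for v
      using ab[of v] z(1)[of v] r_B[OF that] that B_V by auto
    then have "a = 0 \<and> b = 0" by (intro affine_functional_zero[OF hull_B]) auto
    then have "z v = 0" for v using ab z(1)[of v] r_r by (cases "v \<in> r ` V") auto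
    then show False using z(2) by blast
  qed
  obtain d where d: "d > 0"
    "\<And>z. (\<forall>v. v \<notin> ?A \<longrightarrow> z v = 0) \<Longrightarrow> d * (\<Sum>v\<in>?A. (z v)\<^sup>2) \<le> form M \<omega> (z \<circ> r) (z \<circ> r)"
    using Q.coercive[OF fin pos] by blast
  \<comment> \<open>Each of the \<open>card V\<close> values \<open>x (r v)\<close> is bounded by
    the sum over representatives; the 1 keeps the divisor positive.\<close>
  define N where "N = real (card V) + 1"
  have N: "N > 0" by (simp add: N_def)
  have "d / N * (size_V (\<lambda>v. x (r v)))\<^sup>2 \<le> form M \<omega> (x \<circ> r) (x \<circ> r)" if x: "\<forall>v\<in>B. x v = 0" for x
  proof -
    define z where "z v = (if v \<in> ?A then x v else 0)" for v
    have zx: "z (r v) = x (r v)" if "v \<in> V" for v using that x by (auto simp: z_def)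
    have le: "(x (r v))\<^sup>2 \<le> (\<Sum>v\<in>?A. (z v)\<^sup>2)" if "v \<in> V" for v
    proof (cases "r v \<in> ?A")
      case True
      then show ?thesis using member_le_sum[of "r v" ?A "\<lambda>v. (z v)\<^sup>2"] fin zx[OF that] by auto
    next
      case False
      then have "z (r v) = 0" unfolding z_def by (rule if_not_P)
      then show ?thesis using zx[OF that] by (simp add: sum_nonneg)
    qed
    have "(size_V (\<lambda>v. x (r v)))\<^sup>2 = (\<Sum>v\<in>V. (x (r v))\<^sup>2)" by (simp add: L2_set_def sum_nonneg)
    also have "\<dots> \<le> card V * (\<Sum>v\<in>?A. (z v)\<^sup>2)" using sum_bounded_above[OF le] by simp
    also have "\<dots> \<le> N * (\<Sum>v\<in>?A. (z v)\<^sup>2)" by (intro mult_right_mono sum_nonneg) (auto simp: N_def)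
    finally have "d / N * (size_V (\<lambda>v. x (r v)))\<^sup>2 \<le> d / N * (N * (\<Sum>v\<in>?A. (z v)\<^sup>2))"
      using d(1) N by (intro mult_left_mono) auto
    also have "\<dots> = d * (\<Sum>v\<in>?A. (z v)\<^sup>2)" using N by simp
    also have "\<dots> \<le> form M \<omega> (z \<circ> r) (z \<circ> r)" by (intro d) (auto simp: z_def)
    also have "\<dots> = form M \<omega> (x \<circ> r) (x \<circ> r)"
      by (rule form_cong_V[OF M_E]) (auto simp: zx)
    finally show ?thesis .
  qed
  then show ?thesis using d(1) N by (intro exI[of _ "d / N"]) auto
qed

definition vanishing :: "('v \<Rightarrow> real) \<Rightarrow> bool" where
  "vanishing z \<longleftrightarrow> (\<forall>v\<in>B. z v = 0)"

text \<open>Split x into its fibrewise constant part \<open>x \<circ> r\<close>, controlled by the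
  quotient, and the rest, controlled by \<open>size_I x\<close>. Half of the large inner energy
  absorbs the mixed terms; the other half stays in the bound, and \<delta> does not depend on
  \<epsilon>.\<close>

lemma coercive_weight:
  "\<exists>\<delta>>0. \<exists>\<kappa>\<^sub>0>0. \<exists>\<epsilon>\<^sub>0>0. \<forall>\<epsilon> c x. 0 < \<epsilon> \<and> \<epsilon> \<le> \<epsilon>\<^sub>0 \<and> (\<forall>e\<in>M. \<bar>c e\<bar> \<le> \<kappa>\<^sub>0) \<and> vanishing x \<longrightarrow>
     \<delta> * (size_V x)\<^sup>2 + (size_I x)\<^sup>2 / (2 * \<epsilon>) \<le> form E (weight \<epsilon> c) x x"
proof -
  obtain C where C: "C \<ge> 0" "\<And>x. size_V (\<lambda>v. x v - x (r v)) \<le> C * size_I x"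
    using fibre_bound by blast
  obtain d where d: "d > 0"
    "\<And>x. vanishing x \<Longrightarrow> d * (size_V (\<lambda>v. x (r v)))\<^sup>2 \<le> form M \<omega> (x \<circ> r) (x \<circ> r)"
    using coercive_quotient unfolding vanishing_def by blast
  define k where "k = (\<Sum>e\<in>M. \<bar>\<omega> e\<bar>)"
  have k: "\<bar>\<omega> e\<bar> \<le> k" if "e \<in> M" for e
    unfolding k_def using member_le_sum[of e M "\<lambda>e. \<bar>\<omega> e\<bar>"] that finite_parts(2) by auto
  define m where "m = real (card M)"
  define K where "K = 4 * m * k"
  have K: "K \<ge> 0" unfolding K_def m_def k_def by (intro mult_nonneg_nonneg sum_nonneg) auto
  \<comment> \<open>Collects all coefficients with which the part off the quotient enters
    negatively. The bound \<epsilon> \<le> 1 / (2 * L) makes \<open>L\<close> at most half of the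
    inner weight.\<close>
  define L where "L = (d / 2 + 2 * K\<^sup>2 / d + K) * C\<^sup>2 + 1"
  have L: "L > 0" unfolding L_def using d K C by (intro add_nonneg_pos mult_nonneg_nonneg) auto
  \<comment> \<open>The cross terms and the passage from \<open>y\<close> to \<open>n\<close> leave
    d / 4 of the quotient coercivity; the correction \<open>c\<close> may use up half of
    that.\<close>
  define \<kappa> where "\<kappa> = d / (32 * (m + 1))"
  have \<kappa>: "\<kappa> > 0" "4 * m * \<kappa> \<le> d / 8"
    using d by (auto simp: \<kappa>_def m_def field_simps add_pos_nonneg intro!: divide_pos_pos)
  have "d / 8 * (size_V x)\<^sup>2 + (size_I x)\<^sup>2 / (2 * \<epsilon>) \<le> form E (weight \<epsilon> c) x x"
    if \<epsilon>: "0 < \<epsilon>" "\<epsilon> \<le> 1 / (2 * L)" and c: "\<And>e. e \<in> M \<Longrightarrow> \<bar>c e\<bar> \<le> \<kappa>" and x: "vanishing x" for \<epsilon> c x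
  proof -
    define n where "n = size_V x"
    define i where "i = size_I x"
    define y where "y = size_V (\<lambda>v. x (r v))"
    define z where "z = size_V (\<lambda>v. x v - x (r v))"
    interpret F: sym_bilinear_form "form M \<omega>" by (rule edge_form_bilinear)
    have nn: "n \<ge> 0" "i \<ge> 0" "y \<ge> 0" "z \<ge> 0" by (simp_all add: n_def i_def y_def z_def)
    have zi: "z\<^sup>2 \<le> C\<^sup>2 * i\<^sup>2"
      using power_mono[OF C(2)[of x], of 2] by (simp add: z_def i_def power_mult_distrib)
    have "n \<le> y + z"
      using L2_set_triangle_ineq[of "\<lambda>v. x (r v)" "\<lambda>v. x v - x (r v)" V] by (simp add: n_def y_def z_def)
    then have n2: "n\<^sup>2 \<le> 2 * y\<^sup>2 + 2 * z\<^sup>2"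
      using power_mono[of n "y + z" 2] square_add_le[of y z] nn by linarith
    have "form M \<omega> x x = form M \<omega> (x \<circ> r) (x \<circ> r) + 2 * form M \<omega> (x \<circ> r) (\<lambda>v. x v - x (r v))
        + form M \<omega> (\<lambda>v. x v - x (r v)) (\<lambda>v. x v - x (r v))"
      using F.square_add[of "x \<circ> r" "\<lambda>v. x v - x (r v)"] by simp
    moreover have "d * y\<^sup>2 \<le> form M \<omega> (x \<circ> r) (x \<circ> r)" unfolding y_def by (rule d(2)[OF x])
    moreover have "\<bar>form M \<omega> (x \<circ> r) (\<lambda>v. x v - x (r v))\<bar> \<le> K * y * z"
      using form_bound[OF M_E k, where x = "x \<circ> r" and y = "\<lambda>v. x v - x (r v)"] by (simp add: K_def m_def y_def z_def comp_def)
    moreover have "\<bar>form M \<omega> (\<lambda>v. x v - x (r v)) (\<lambda>v. x v - x (r v))\<bar> \<le> K * z\<^sup>2"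
      using form_bound[OF M_E k, where x = "\<lambda>v. x v - x (r v)" and y = "\<lambda>v. x v - x (r v)"]
      by (simp add: K_def m_def z_def power2_eq_square mult.assoc)
    \<comment> \<open>Young's inequality, scaled so that half of the coercive term in
      \<open>y\<close> survives.\<close>
    moreover have "2 * (K * y * z) \<le> d / 2 * y\<^sup>2 + 2 * K\<^sup>2 / d * z\<^sup>2"
    proof -
      have "0 \<le> (d * y - 2 * K * z)\<^sup>2 / (2 * d)" using d by simp
      also have "\<dots> = d / 2 * y\<^sup>2 + 2 * K\<^sup>2 / d * z\<^sup>2 - 2 * (K * y * z)"
        using d by (simp add: field_simps power2_eq_square)
      finally show ?thesis by simp
    qed
    ultimately have A: "form M \<omega> x x \<ge> d / 2 * y\<^sup>2 - (2 * K\<^sup>2 / d + K) * z\<^sup>2"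
      by (simp add: distrib_right)
    have "\<bar>form M c x x\<bar> \<le> (4 * m * \<kappa>) * n\<^sup>2"
      using form_bound[OF M_E c, where x = x and y = x] by (simp add: m_def n_def power2_eq_square mult.assoc)
    also have "\<dots> \<le> d / 8 * n\<^sup>2" using \<kappa>(2) by (intro mult_right_mono) auto
    finally have Bd: "form M c x x \<ge> - (d / 8 * n\<^sup>2)" by linarith
    have "d / 4 * n\<^sup>2 \<le> d / 4 * (2 * y\<^sup>2 + 2 * z\<^sup>2)" using n2 d by (intro mult_left_mono) auto
    then have "d / 2 * y\<^sup>2 \<ge> d / 4 * n\<^sup>2 - d / 2 * z\<^sup>2" by (simp add: algebra_simps)
    then have "form M \<omega> x x + form M c x x \<ge> d / 8 * n\<^sup>2 - (d / 2 + 2 * K\<^sup>2 / d + K) * z\<^sup>2"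
      using A Bd by (simp add: distrib_right)
    moreover have "(d / 2 + 2 * K\<^sup>2 / d + K) * z\<^sup>2 \<le> (d / 2 + 2 * K\<^sup>2 / d + K) * (C\<^sup>2 * i\<^sup>2)"
      using zi d K by (intro mult_left_mono) auto
    moreover have "\<dots> \<le> L * i\<^sup>2" by (simp add: L_def distrib_right mult.assoc)
    moreover have "L * i\<^sup>2 \<le> 1 / (2 * \<epsilon>) * i\<^sup>2"
      using \<epsilon> L by (intro mult_right_mono) (auto simp: field_simps)
    moreover have "form E (weight \<epsilon> c) x x \<ge> 1 / \<epsilon> * i\<^sup>2 + (form M \<omega> x x + form M c x x)"
      unfolding form_weight form_inner i_def using form_other_nonneg[of x] \<epsilon>(1) by simp
    moreover have "1 / \<epsilon> * i\<^sup>2 = 1 / (2 * \<epsilon>) * i\<^sup>2 + 1 / (2 * \<epsilon>) * i\<^sup>2" using \<epsilon>(1) by (simp add: field_simps)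
    ultimately show ?thesis unfolding n_def[symmetric] i_def[symmetric] by simp
  qed
  then show ?thesis using d(1) \<kappa>(1) L
    by (intro exI[of _ "d / 8"] conjI exI[of _ \<kappa>] exI[of _ "1 / (2 * L)"]) auto
qed

text \<open>The old coordinate a . p is constant on fibres, so the stiff edges do not see it, and by
  the equilibrium in the minor it is orthogonal to all fibrewise constant functions. What remains is
  controlled by \<open>size_I z\<close> and the small weights, with no factor 1 / \<epsilon>. The
  bound 2 for \<open>a\<close> admits sums and differences of two unit vectors, as polarization
  requires.\<close>

lemma cross_bound:
  "\<exists>K\<ge>0. \<forall>\<epsilon> c \<kappa> a z. 0 < \<epsilon> \<and> 0 \<le> \<kappa> \<and> (\<forall>e\<in>M. \<bar>c e\<bar> \<le> \<kappa>) \<and> norm a \<le> 2 \<longrightarrow>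
     \<bar>form E (weight \<epsilon> c) (\<lambda>v. a \<bullet> p v) z\<bar> \<le> K * (size_I z + (\<kappa> + \<epsilon>) * size_V z)
     \<and> form other_edges (\<lambda>_. 1) (\<lambda>v. a \<bullet> p v) (\<lambda>v. a \<bullet> p v) \<le> K
     \<and> form E (weight \<epsilon> c) (\<lambda>v. a \<bullet> p v) (\<lambda>v. a \<bullet> p v) =
         form M c (\<lambda>v. a \<bullet> p v) (\<lambda>v. a \<bullet> p v) + \<epsilon> * form other_edges (\<lambda>_. 1) (\<lambda>v. a \<bullet> p v) (\<lambda>v. a \<bullet> p v)"
proof -
  obtain C where C: "C \<ge> 0" "\<And>x. size_V (\<lambda>v. x v - x (r v)) \<le> C * size_I x"
    using fibre_bound by blast
  define k where "k = (\<Sum>e\<in>M. \<bar>\<omega> e\<bar>)"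
  have k0: "k \<ge> 0" unfolding k_def by (intro sum_nonneg) auto
  have k: "\<bar>\<omega> e\<bar> \<le> k" if "e \<in> M" for e
    unfolding k_def using member_le_sum[of e M "\<lambda>e. \<bar>\<omega> e\<bar>"] that finite_parts(2) by auto
  define P where "P = 2 * (\<Sum>v\<in>V. norm (p v))"
  have P0: "P \<ge> 0" unfolding P_def by (intro mult_nonneg_nonneg sum_nonneg) auto
  define m where "m = real (card E)"
  have m: "0 \<le> m" "real (card M) \<le> m" "real (card other_edges) \<le> m"
    unfolding m_def using parts_subset finite_E by (auto intro: card_mono)
  \<comment> \<open>The summands serve, in this order, the cross term with \<omega>, the cross terms
    with \<open>c\<close> and \<epsilon>, and the energy of a . p on the other edges.\<close>
  define K where "K = 4 * m * k * P * C + 4 * m * P + 4 * m * P * P"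
  have K: "4 * m * k * P * C \<le> K" "4 * m * P \<le> K" "4 * m * P * P \<le> K" "0 \<le> K"
    using m k0 P0 C by (simp_all add: K_def)
  show ?thesis
  proof (intro exI[of _ K] conjI allI impI)
    fix \<epsilon> \<kappa> :: real and c :: "'e \<Rightarrow> real" and a :: "real ^ 'd" and z :: "'v \<Rightarrow> real"
    assume "0 < \<epsilon> \<and> 0 \<le> \<kappa> \<and> (\<forall>e\<in>M. \<bar>c e\<bar> \<le> \<kappa>) \<and> norm a \<le> 2"
    then have \<epsilon>: "0 < \<epsilon>" and \<kappa>: "0 \<le> \<kappa>" and c: "\<And>e. e \<in> M \<Longrightarrow> \<bar>c e\<bar> \<le> \<kappa>" and a: "norm a \<le> 2" by auto
    let ?P = "\<lambda>v. a \<bullet> p v"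
    have sP: "size_V ?P \<le> P"
    proof -
      have "size_V ?P \<le> (\<Sum>v\<in>V. \<bar>a \<bullet> p v\<bar>)" by (rule L2_set_le_sum_abs)
      also have "\<dots> \<le> (\<Sum>v\<in>V. 2 * norm (p v))"
        using a by (intro sum_mono order_trans[OF Cauchy_Schwarz_ineq2] mult_right_mono) auto
      finally show ?thesis by (simp add: P_def sum_distrib_left)
    qed
    have inner0: "form inner_edges (\<lambda>_. 1) ?P y = 0" for y
      unfolding edge_form_def
    proof (intro sum.neutral ballI)
      fix e assume "e \<in> inner_edges"
      then have e: "e \<in> E" "r (s e) = r (t e)" by (auto simp: inner_edges_def)
      then have "p (s e) = p (t e)" using p_r[OF ends_V(1)[OF e(1)]] p_r[OF ends_V(2)[OF e(1)]] by simp
      then show "1 * (a \<bullet> p (s e) - a \<bullet> p (t e)) * (y (s e) - y (t e)) = 0" by simp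
    qed
    have stress0: "form M \<omega> (y \<circ> r) ?P = 0" for y
      using edge_form_affine[of s t M \<omega> "y \<circ> r" p 0 a] stress[of y] by simp
    have PP: "form M \<omega> ?P ?P = 0"
      using stress0[of ?P] form_cong_V[OF M_E, of "?P \<circ> r" ?P ?P ?P] p_r by simp
    have o: "\<bar>form other_edges (\<lambda>_. 1) ?P y\<bar> \<le> 4 * m * P * size_V y" for y
    proof -
      have "\<bar>form other_edges (\<lambda>_. 1) ?P y\<bar> \<le> 4 * real (card other_edges) * 1 * size_V ?P * size_V y"
        by (rule form_bound[OF parts_subset(3)]) auto
      also have "\<dots> \<le> 4 * m * 1 * P * size_V y"
        using m sP P0 by (intro mult_mono mult_nonneg_nonneg) auto
      finally show ?thesis by simp
    qed
    have "form M \<omega> ?P z = form M \<omega> (\<lambda>v. z v - z (r v)) ?P"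
      using sym_bilinear_form.diff[OF edge_form_bilinear, of s t M \<omega> z "z \<circ> r" ?P] stress0[of z]
      by (simp add: edge_form_sym[of s t M \<omega> ?P])
    moreover have "\<bar>form M \<omega> (\<lambda>v. z v - z (r v)) ?P\<bar> \<le> 4 * real (card M) * k * size_V (\<lambda>v. z v - z (r v)) * size_V ?P"
      by (rule form_bound[OF M_E k])
    moreover have "\<dots> \<le> 4 * m * k * (C * size_I z) * P"
      using m k0 sP P0 C by (intro mult_mono mult_nonneg_nonneg) auto
    moreover have "4 * m * k * (C * size_I z) * P = (4 * m * k * P * C) * size_I z" by simp
    moreover have "\<dots> \<le> K * size_I z" using K(1) by (intro mult_right_mono) auto
    ultimately have 1: "\<bar>form M \<omega> ?P z\<bar> \<le> K * size_I z" by linarith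
    have "\<bar>form M c ?P z\<bar> \<le> 4 * real (card M) * \<kappa> * size_V ?P * size_V z"
      by (rule form_bound[OF M_E c])
    also have "\<dots> \<le> 4 * m * \<kappa> * P * size_V z"
      using m sP P0 \<kappa> by (intro mult_mono mult_nonneg_nonneg) auto
    also have "\<dots> = 4 * m * P * (\<kappa> * size_V z)" by simp
    also have "\<dots> \<le> K * (\<kappa> * size_V z)" using K(2) \<kappa> by (intro mult_right_mono) auto
    finally have 2: "\<bar>form M c ?P z\<bar> \<le> K * (\<kappa> * size_V z)" .
    have "\<bar>\<epsilon> * form other_edges (\<lambda>_. 1) ?P z\<bar> \<le> \<epsilon> * (4 * m * P * size_V z)"
      using o[of z] \<epsilon> by (simp add: abs_mult)
    also have "\<dots> = 4 * m * P * (\<epsilon> * size_V z)" by simp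
    also have "\<dots> \<le> K * (\<epsilon> * size_V z)" using K(2) \<epsilon> by (intro mult_right_mono) auto
    finally have "\<bar>\<epsilon> * form other_edges (\<lambda>_. 1) ?P z\<bar> \<le> K * (\<epsilon> * size_V z)" .
    with 1 2 show "\<bar>form E (weight \<epsilon> c) ?P z\<bar> \<le> K * (size_I z + (\<kappa> + \<epsilon>) * size_V z)"
      unfolding form_weight inner0 by (simp add: distrib_left distrib_right)
    show "form other_edges (\<lambda>_. 1) ?P ?P \<le> K"
    proof -
      have "form other_edges (\<lambda>_. 1) ?P ?P \<le> 4 * m * P * size_V ?P" using o[of ?P] by linarith
      also have "\<dots> \<le> 4 * m * P * P" using sP m P0 by (intro mult_left_mono) auto
      finally show ?thesis using K(3) by linarith
    qed
    show "form E (weight \<epsilon> c) ?P ?P = form M c ?P ?P + \<epsilon> * form other_edges (\<lambda>_. 1) ?P ?P"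
      unfolding form_weight inner0 PP by simp
  qed (rule K(4))
qed

end

section \<open>Harmonic extensions\<close>

lemma quadratic_form_sum:
  fixes v :: "real ^ 'd"
  shows "v \<bullet> (S *v v) = (\<Sum>k\<in>UNIV. \<Sum>l\<in>UNIV. S $ k $ l * (v $ k * v $ l))"
  by (simp add: inner_vec_def matrix_vector_mult_def sum_distrib_left mult_ac)

lemma abs_entry_le_norm: "\<bar>X $ i $ j\<bar> \<le> norm X" for X :: "real ^ 'd ^ 'd"
  using component_le_norm_cart[of "X $ i" j] Finite_Cartesian_Product.norm_nth_le[of X i] by linarith

lemma norm_le_entries:
  fixes X :: "real ^ 'd ^ 'd"
  assumes "\<And>i j. \<bar>X $ i $ j\<bar> \<le> c"
  shows "norm X \<le> (real CARD('d))\<^sup>2 * c"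
proof -
  have "norm X \<le> (\<Sum>i\<in>UNIV. norm (X $ i))"
    unfolding norm_vec_def by (rule L2_set_le_sum) auto
  also have "\<dots> \<le> (\<Sum>i\<in>UNIV. \<Sum>j\<in>UNIV. \<bar>X $ i $ j\<bar>)"
    by (intro sum_mono norm_le_l1_cart)
  also have "\<dots> \<le> (\<Sum>i\<in>(UNIV :: 'd set). \<Sum>j\<in>(UNIV :: 'd set). c)"
    by (intro sum_mono assms)
  finally show ?thesis by (simp add: power2_eq_square)
qed

lemma subspace_symmetric: "subspace {X :: real ^ 'd ^ 'd. transpose X = X}"
  by (auto simp: subspace_def transpose_def vec_eq_iff)

context contraction
begin

section \<open>Condition (ii) as a linear system for the weights on the minor\<close>

definition edge_vec :: "'e \<Rightarrow> real ^ 'd" where "edge_vec e = p (s e) - p (t e)"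

text \<open>By \<open>rigid\<close>, no nonzero symmetric matrix is orthogonal to all outer products
  of edge vectors, so these span the symmetric matrices. The weights \<open>\<tau> i j\<close>
  produce the symmetrized matrix unit at (i, j).\<close>

lemma stress_coordinates:
  obtains \<tau> :: "'d \<Rightarrow> 'd \<Rightarrow> 'e \<Rightarrow> real" where
    "\<And>X k l. transpose X = X \<Longrightarrow>
      (\<Sum>e\<in>M. (\<Sum>i\<in>UNIV. \<Sum>j\<in>UNIV. X $ i $ j * \<tau> i j e) * (edge_vec e $ k * edge_vec e $ l)) = X $ k $ l"
proof -
  define outer :: "'e \<Rightarrow> real ^ 'd ^ 'd" where "outer e = (\<chi> k l. edge_vec e $ k * edge_vec e $ l)" for e
  define R where "R = range (\<lambda>c. \<Sum>e\<in>M. c e *\<^sub>R outer e)"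
  let ?Sym = "{X :: real ^ 'd ^ 'd. transpose X = X}"
  have "subspace R"
    unfolding subspace_def
  proof (intro conjI ballI allI)
    show "0 \<in> R" unfolding R_def by (intro image_eqI[of _ _ "\<lambda>_. 0"]) auto
    show "X + Y \<in> R" if "X \<in> R" "Y \<in> R" for X Y
    proof -
      obtain c c' where "X = (\<Sum>e\<in>M. c e *\<^sub>R outer e)" "Y = (\<Sum>e\<in>M. c' e *\<^sub>R outer e)"
        using \<open>X \<in> R\<close> \<open>Y \<in> R\<close> unfolding R_def by blast
      then have "X + Y = (\<Sum>e\<in>M. (c e + c' e) *\<^sub>R outer e)"
        by (simp add: scaleR_add_left sum.distrib)
      then show ?thesis unfolding R_def by (intro image_eqI[of _ _ "\<lambda>e. c e + c' e"]) auto
    qed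
    show "a *\<^sub>R X \<in> R" if X: "X \<in> R" for a X
    proof -
      obtain c where "X = (\<Sum>e\<in>M. c e *\<^sub>R outer e)" using X unfolding R_def by blast
      then have "a *\<^sub>R X = (\<Sum>e\<in>M. (a * c e) *\<^sub>R outer e)" by (simp add: scaleR_sum_right)
      then show ?thesis unfolding R_def by (intro image_eqI[of _ _ "\<lambda>e. a * c e"]) auto
    qed
  qed
  moreover have "outer e \<in> ?Sym" for e
    by (simp add: outer_def transpose_def vec_eq_iff)
  then have R_Sym: "R \<subseteq> ?Sym"
    unfolding R_def
    by (intro image_subsetI subspace_sum[OF subspace_symmetric] subspace_scale[OF subspace_symmetric])
  ultimately have "R = ?Sym"
  proof (rule_tac ccontr)
    assume "subspace R" and neq: "R \<noteq> ?Sym"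
    then have spans: "span R = R" "span ?Sym = ?Sym"
      using subspace_symmetric by (simp_all only: span_eq_iff)
    have "span R \<subset> span ?Sym" unfolding spans using R_Sym neq by (rule psubsetI)
    then obtain Y where Y: "Y \<noteq> 0" "Y \<in> span ?Sym" "\<And>Z. Z \<in> span R \<Longrightarrow> orthogonal Y Z"
      using orthogonal_to_subspace_exists_gen by blast
    have Ysym: "transpose Y = Y" using Y(2) unfolding spans by blast
    have "edge_vec e \<bullet> (Y *v edge_vec e) = 0" if "e \<in> M" for e
    proof -
      have "outer e = (\<Sum>e'\<in>M. (if e' = e then 1 else 0) *\<^sub>R outer e')"
        using that finite_parts(2) by (simp add: if_distrib[of "\<lambda>c. c *\<^sub>R _"] cong: if_cong)
      then have "outer e \<in> R" unfolding R_def
        by - (rule image_eqI[of _ _ "\<lambda>e'. if e' = e then 1 else 0"], assumption, rule UNIV_I)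
      then have "Y \<bullet> outer e = 0" using Y(3) span_base unfolding orthogonal_def by blast
      then show ?thesis unfolding quadratic_form_sum by (simp add: inner_vec_def outer_def)
    qed
    then show False using rigid[OF Ysym] Y(1) unfolding edge_vec_def by blast
  qed
  have "\<forall>i j. \<exists>c. (\<Sum>e\<in>M. c e *\<^sub>R outer e) =
      (\<chi> k l. ((if k = i \<and> l = j then 1 else 0) + (if k = j \<and> l = i then 1 else 0)) / 2)"
  proof (intro allI)
    fix i j :: 'd
    let ?U = "(\<chi> k l. ((if k = i \<and> l = j then 1 else 0) + (if k = j \<and> l = i then 1 else 0)) / 2) :: real ^ 'd ^ 'd"
    have "?U \<in> ?Sym"
      unfolding mem_Collect_eq transpose_def vec_eq_iff vec_lambda_beta
      by (intro allI arg_cong2[of _ _ _ _ "(/)"] refl)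
        (subst add.commute, rule arg_cong2[of _ _ _ _ "(+)"], simp_all only: conj_commute)
    then have "?U \<in> R" using \<open>R = ?Sym\<close> by blast
    then obtain c where "?U = (\<Sum>e\<in>M. c e *\<^sub>R outer e)" unfolding R_def by (rule rangeE)
    then show "\<exists>c. (\<Sum>e\<in>M. c e *\<^sub>R outer e) = ?U" by (intro exI[of _ c]) (rule sym)
  qed
  then obtain \<tau> where \<tau>: "\<And>i j. (\<Sum>e\<in>M. \<tau> i j e *\<^sub>R outer e) =
      (\<chi> k l. ((if k = i \<and> l = j then 1 else 0) + (if k = j \<and> l = i then 1 else 0)) / 2)"
    by metis
  have entry: "(\<Sum>e\<in>M. \<tau> i j e * (edge_vec e $ k * edge_vec e $ l)) =
      ((if k = i \<and> l = j then 1 else 0) + (if k = j \<and> l = i then 1 else 0)) / 2" for i j k l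
  proof -
    have "(\<Sum>e\<in>M. \<tau> i j e *\<^sub>R outer e) $ k $ l =
      ((if k = i \<and> l = j then 1 else 0) + (if k = j \<and> l = i then 1 else 0)) / 2"
      unfolding \<tau> by simp
    then show ?thesis by (simp add: outer_def)
  qed
  show thesis
  proof (rule that)
    fix X :: "real ^ 'd ^ 'd" and k l assume X: "transpose X = X"
    have "(\<Sum>e\<in>M. (\<Sum>i\<in>UNIV. \<Sum>j\<in>UNIV. X $ i $ j * \<tau> i j e) * (edge_vec e $ k * edge_vec e $ l)) =
        (\<Sum>e\<in>M. \<Sum>i\<in>UNIV. \<Sum>j\<in>UNIV. X $ i $ j * (\<tau> i j e * (edge_vec e $ k * edge_vec e $ l)))"
      by (simp add: sum_distrib_right mult.assoc)
    also have "\<dots> = (\<Sum>i\<in>UNIV. \<Sum>e\<in>M. \<Sum>j\<in>UNIV. X $ i $ j * (\<tau> i j e * (edge_vec e $ k * edge_vec e $ l)))"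
      by (rule sum.swap)
    also have "\<dots> = (\<Sum>i\<in>UNIV. \<Sum>j\<in>UNIV. \<Sum>e\<in>M. X $ i $ j * (\<tau> i j e * (edge_vec e $ k * edge_vec e $ l)))"
      by (intro sum.cong refl sum.swap)
    also have "\<dots> = (\<Sum>i\<in>UNIV. \<Sum>j\<in>UNIV. X $ i $ j *
        (((if k = i \<and> l = j then 1 else 0) + (if k = j \<and> l = i then 1 else 0)) / 2))"
      by (simp only: sum_distrib_left[symmetric] entry)
    \<comment> \<open>Half of the entry is picked up at (k, l) and half at (l, k); symmetry of
      \<open>X\<close> recombines them.\<close>
    also have "\<dots> = (\<Sum>i\<in>UNIV. \<Sum>j\<in>UNIV. (if j = l then if i = k then X $ i $ j / 2 else 0 else 0)
        + (if j = k then if i = l then X $ i $ j / 2 else 0 else 0))"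
      by (intro sum.cong refl) auto
    also have "\<dots> = X $ k $ l / 2 + X $ l $ k / 2" by (simp add: sum.distrib)
    also have "\<dots> = X $ k $ l" using X by (simp add: transpose_def vec_eq_iff)
    finally show "(\<Sum>e\<in>M. (\<Sum>i\<in>UNIV. \<Sum>j\<in>UNIV. X $ i $ j * \<tau> i j e) * (edge_vec e $ k * edge_vec e $ l)) = X $ k $ l" .
  qed
qed

text \<open>\<open>T X\<close> is the correction of the weights on \<open>M\<close> whose
  first-order effect on the energies of the coordinates is exactly \<open>X\<close>.\<close>

lemma rigid_coordinates:
  obtains T :: "real ^ 'd ^ 'd \<Rightarrow> 'e \<Rightarrow> real" and C where
    "\<forall>e. linear (\<lambda>X. T X e)"
    "\<forall>X k l. transpose X = X \<longrightarrow> (\<Sum>e\<in>M. T X e * (edge_vec e $ k * edge_vec e $ l)) = X $ k $ l"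
    "C > 0" "\<forall>X. \<forall>e\<in>M. \<bar>T X e\<bar> \<le> C * norm X"
proof -
  obtain \<tau> :: "'d \<Rightarrow> 'd \<Rightarrow> 'e \<Rightarrow> real" where \<tau>:
    "\<And>X k l. transpose X = X \<Longrightarrow>
      (\<Sum>e\<in>M. (\<Sum>i\<in>UNIV. \<Sum>j\<in>UNIV. X $ i $ j * \<tau> i j e) * (edge_vec e $ k * edge_vec e $ l)) = X $ k $ l"
    using stress_coordinates by blast
  define T where "T X e = (\<Sum>i\<in>UNIV. \<Sum>j\<in>UNIV. X $ i $ j * \<tau> i j e)" for X :: "real ^ 'd ^ 'd" and e
  define C where "C = 1 + (\<Sum>e\<in>M. \<Sum>i\<in>UNIV. \<Sum>j\<in>UNIV. \<bar>\<tau> i j e\<bar>)"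
  have bound: "\<bar>T X e\<bar> \<le> C * norm X" if e: "e \<in> M" for X e
  proof -
    have "\<bar>T X e\<bar> \<le> (\<Sum>i\<in>UNIV. \<Sum>j\<in>UNIV. \<bar>X $ i $ j * \<tau> i j e\<bar>)"
      unfolding T_def by (intro order_trans[OF sum_abs] sum_mono sum_abs)
    also have "\<dots> \<le> (\<Sum>i\<in>UNIV. \<Sum>j\<in>UNIV. norm X * \<bar>\<tau> i j e\<bar>)"
      unfolding abs_mult by (intro sum_mono mult_right_mono abs_entry_le_norm) auto
    also have "\<dots> = norm X * (\<Sum>i\<in>UNIV. \<Sum>j\<in>UNIV. \<bar>\<tau> i j e\<bar>)" by (simp add: sum_distrib_left)
    also have "\<dots> \<le> norm X * C"
    proof (rule mult_left_mono)
      have "(\<Sum>i\<in>UNIV. \<Sum>j\<in>UNIV. \<bar>\<tau> i j e\<bar>) \<le> (\<Sum>e\<in>M. \<Sum>i\<in>UNIV. \<Sum>j\<in>UNIV. \<bar>\<tau> i j e\<bar>)"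
        by (rule member_le_sum) (use e finite_parts(2) in \<open>auto intro!: sum_nonneg\<close>)
      then show "(\<Sum>i\<in>UNIV. \<Sum>j\<in>UNIV. \<bar>\<tau> i j e\<bar>) \<le> C" unfolding C_def by linarith
    qed simp
    finally show ?thesis by (simp add: mult.commute)
  qed
  have "linear (\<lambda>X. T X e)" for e
    by (rule linearI) (simp_all add: T_def distrib_right sum.distrib sum_distrib_left mult.assoc)
  moreover have "C > 0" unfolding C_def by (intro add_pos_nonneg sum_nonneg) auto
  ultimately show thesis using that[of T C] \<tau> bound unfolding T_def by blast
qed

text \<open>\<open>T\<close> recovers a symmetric \<open>S\<close> from its values on the edge
  vectors: the squared norm of \<open>S\<close> is the sum of these values weighted by
  \<open>T S\<close>. If they vanish for \<open>p'\<close>, they are of order \<eta> times the norm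
  of \<open>S\<close> for \<open>p\<close>, which gives a contradiction for small \<eta> unless
  \<open>S\<close> is zero.\<close>

lemma rigid_perturbed:
  "\<exists>\<eta>>0. \<forall>p' :: 'v \<Rightarrow> real ^ 'd. (\<forall>v\<in>V. \<forall>k. \<bar>p' v $ k - p v $ k\<bar> \<le> \<eta>) \<longrightarrow>
    (\<forall>S. transpose S = S \<longrightarrow> (\<forall>e\<in>M. (p' (s e) - p' (t e)) \<bullet> (S *v (p' (s e) - p' (t e))) = 0) \<longrightarrow> S = 0)"
proof -
  obtain T C where "\<forall>e. linear (\<lambda>X. T X e)"
    and T': "\<forall>X k l. transpose X = X \<longrightarrow> (\<Sum>e\<in>M. T X e * (edge_vec e $ k * edge_vec e $ l)) = X $ k $ l"
    and C: "C > 0" "\<forall>X. \<forall>e\<in>M. \<bar>T X e\<bar> \<le> C * norm X"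
    by (rule rigid_coordinates)
  note T = T'[rule_format]
  define P where "P = (\<Sum>e\<in>M. norm (edge_vec e))"
  have P0: "P \<ge> 0" unfolding P_def by (intro sum_nonneg) auto
  have P: "\<bar>edge_vec e $ k\<bar> \<le> P" if "e \<in> M" for e k
    using component_le_norm_cart[of "edge_vec e" k] member_le_sum[of e M "\<lambda>e. norm (edge_vec e)"]
      that finite_parts(2) unfolding P_def by simp
  define m where "m = real (card M) * C * (real CARD('d))\<^sup>2 + 1"
  have m: "m > 0" unfolding m_def using C by (intro add_nonneg_pos) auto
  \<comment> \<open>The cap 1 / 2 keeps the perturbed edge coordinates below \<open>P + 1\<close>;
    the other bound makes the final factor at most 1 / 2.\<close>
  define \<eta> where "\<eta> = min (1 / 2) (1 / (8 * m * (P + 1)))"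
  have q: "8 * m * (P + 1) > 0" using m P0 by simp
  have "\<eta> \<le> 1 / (8 * m * (P + 1))" by (simp add: \<eta>_def)
  with q have \<eta>: "\<eta> > 0" "2 * \<eta> \<le> 1" "\<eta> * (8 * m * (P + 1)) \<le> 1"
    by (simp_all only: pos_le_divide_eq) (auto simp: \<eta>_def)
  have "S = 0" if p': "\<And>v k. v \<in> V \<Longrightarrow> \<bar>p' v $ k - p v $ k\<bar> \<le> \<eta>" and S: "transpose S = S"
    and zero: "\<And>e. e \<in> M \<Longrightarrow> (p' (s e) - p' (t e)) \<bullet> (S *v (p' (s e) - p' (t e))) = 0"
    for p' :: "'v \<Rightarrow> real ^ 'd" and S
  proof -
    define d' where "d' e = p' (s e) - p' (t e)" for e
    have quad: "\<bar>edge_vec e \<bullet> (S *v edge_vec e)\<bar> \<le> (real CARD('d))\<^sup>2 * (norm S * (4 * \<eta> * (P + 1)))" if e: "e \<in> M" for e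
    proof -
      have dd: "\<bar>edge_vec e $ k - d' e $ k\<bar> \<le> 2 * \<eta>" for k
      proof -
        have "s e \<in> V" "t e \<in> V" using e M_E ends_V by auto
        then show ?thesis using p'[of "s e" k] p'[of "t e" k] by (simp add: edge_vec_def d'_def)
      qed
      have prod: "\<bar>edge_vec e $ k * edge_vec e $ l - d' e $ k * d' e $ l\<bar> \<le> 4 * \<eta> * (P + 1)" for k l
      proof -
        have "edge_vec e $ k * edge_vec e $ l - d' e $ k * d' e $ l =
          edge_vec e $ k * (edge_vec e $ l - d' e $ l) + (edge_vec e $ k - d' e $ k) * d' e $ l"
          by (simp add: algebra_simps)
        also have "\<bar>\<dots>\<bar> \<le> \<bar>edge_vec e $ k\<bar> * \<bar>edge_vec e $ l - d' e $ l\<bar> + \<bar>edge_vec e $ k - d' e $ k\<bar> * \<bar>d' e $ l\<bar>"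
          by (metis abs_mult abs_triangle_ineq)
        also have "\<dots> \<le> P * (2 * \<eta>) + (2 * \<eta>) * (P + 1)"
        proof (intro add_mono mult_mono)
          show "\<bar>d' e $ l\<bar> \<le> P + 1" using dd[of l] P[OF e, of l] \<eta>(2) by linarith
        qed (use P[OF e] dd P0 \<eta> in auto)
        also have "\<dots> \<le> 4 * \<eta> * (P + 1)" using \<eta>(1) by (simp add: algebra_simps)
        finally show ?thesis .
      qed
      have "edge_vec e \<bullet> (S *v edge_vec e) =
          edge_vec e \<bullet> (S *v edge_vec e) - d' e \<bullet> (S *v d' e)"
        using zero[OF e] by (simp add: d'_def)
      also have "\<dots> = (\<Sum>k\<in>UNIV. \<Sum>l\<in>UNIV. S $ k $ l * (edge_vec e $ k * edge_vec e $ l - d' e $ k * d' e $ l))"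
        unfolding quadratic_form_sum by (simp add: sum_subtractf right_diff_distrib)
      also have "\<bar>\<dots>\<bar> \<le> (\<Sum>k\<in>(UNIV :: 'd set). \<Sum>l\<in>(UNIV :: 'd set). norm S * (4 * \<eta> * (P + 1)))"
        using prod abs_entry_le_norm[of S] 
        by (intro order_trans[OF sum_abs] sum_mono order_trans[OF sum_abs], unfold abs_mult)
          (intro sum_mono mult_mono, auto)
      finally show ?thesis by (simp add: power2_eq_square)
    qed
    have "(norm S)\<^sup>2 = (\<Sum>k\<in>UNIV. \<Sum>l\<in>UNIV. S $ k $ l * S $ k $ l)"
      unfolding power2_norm_eq_inner by (simp add: inner_vec_def)
    also have "\<dots> = (\<Sum>k\<in>UNIV. \<Sum>l\<in>UNIV. S $ k $ l * (\<Sum>e\<in>M. T S e * (edge_vec e $ k * edge_vec e $ l)))"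
      by (simp only: T[OF S])
    also have "\<dots> = (\<Sum>k\<in>UNIV. \<Sum>l\<in>UNIV. \<Sum>e\<in>M. T S e * (S $ k $ l * (edge_vec e $ k * edge_vec e $ l)))"
      by (simp add: sum_distrib_left mult_ac)
    also have "\<dots> = (\<Sum>k\<in>UNIV. \<Sum>e\<in>M. \<Sum>l\<in>UNIV. T S e * (S $ k $ l * (edge_vec e $ k * edge_vec e $ l)))"
      by (intro sum.cong refl sum.swap)
    also have "\<dots> = (\<Sum>e\<in>M. \<Sum>k\<in>UNIV. \<Sum>l\<in>UNIV. T S e * (S $ k $ l * (edge_vec e $ k * edge_vec e $ l)))"
      by (rule sum.swap)
    also have "\<dots> = (\<Sum>e\<in>M. T S e * (edge_vec e \<bullet> (S *v edge_vec e)))"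
      by (simp add: quadratic_form_sum sum_distrib_left)
    also have "\<dots> \<le> (\<Sum>e\<in>M. \<bar>T S e * (edge_vec e \<bullet> (S *v edge_vec e))\<bar>)"
      by (intro sum_mono) auto
    also have "\<dots> \<le> (\<Sum>e\<in>M. (C * norm S) * ((real CARD('d))\<^sup>2 * (norm S * (4 * \<eta> * (P + 1)))))"
      unfolding abs_mult using C quad by (intro sum_mono mult_mono) (auto intro!: mult_nonneg_nonneg)
    also have "\<dots> = (m - 1) * (4 * \<eta> * (P + 1)) * (norm S)\<^sup>2"
      by (simp add: m_def power2_eq_square mult_ac)
    also have "\<dots> \<le> (m * (4 * \<eta> * (P + 1))) * (norm S)\<^sup>2"
      using \<eta>(1) P0 by (intro mult_right_mono) auto
    also have "\<dots> \<le> (1 / 2) * (norm S)\<^sup>2"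
      using \<eta>(3) by (intro mult_right_mono) (auto simp: algebra_simps)
    finally show ?thesis by simp
  qed
  then show ?thesis using \<eta>(1) by blast
qed

text \<open>Orthogonality to all functions vanishing on \<open>B\<close> is the Euler equation for
  minimal energy with the boundary values of the linear function with gradient
  \<open>a\<close>.\<close>

definition harmonic :: "real \<Rightarrow> ('e \<Rightarrow> real) \<Rightarrow> real ^ 'd \<Rightarrow> ('v \<Rightarrow> real) \<Rightarrow> bool" where
  "harmonic \<epsilon> c a x \<longleftrightarrow> (\<forall>v\<in>B. x v = a \<bullet> p v) \<and> (\<forall>z. vanishing z \<longrightarrow> form E (weight \<epsilon> c) x z = 0)"

definition definite :: "real \<Rightarrow> ('e \<Rightarrow> real) \<Rightarrow> bool" where
  "definite \<epsilon> c \<longleftrightarrow> (\<forall>z. vanishing z \<longrightarrow> 0 \<le> form E (weight \<epsilon> c) z z \<and>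
     (form E (weight \<epsilon> c) z z = 0 \<longrightarrow> (\<forall>v\<in>V. z v = 0)))"

lemma harmonic_exists:
  assumes "definite \<epsilon> c"
  shows "\<exists>x. harmonic \<epsilon> c a x"
proof -
  interpret F: sym_bilinear_form "form E (weight \<epsilon> c)" by (rule edge_form_bilinear)
  let ?A = "V - B"
  have fin: "finite ?A" using finite_V by blast
  have pos: "form E (weight \<epsilon> c) z z > 0" if z: "\<And>v. v \<notin> ?A \<Longrightarrow> z v = 0" "\<exists>v. z v \<noteq> 0" for z
  proof -
    have "vanishing z" unfolding vanishing_def using z(1) by blast
    moreover have "\<exists>v\<in>V. z v \<noteq> 0" using z by blast
    ultimately have "0 \<le> form E (weight \<epsilon> c) z z" "form E (weight \<epsilon> c) z z \<noteq> 0"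
      using assms unfolding definite_def by blast+
    then show ?thesis by simp
  qed
  obtain z where z: "\<forall>v. v \<notin> ?A \<longrightarrow> z v = 0"
    "\<forall>y. (\<forall>v. v \<notin> ?A \<longrightarrow> y v = 0) \<longrightarrow> form E (weight \<epsilon> c) (\<lambda>v. a \<bullet> p v + z v) y = 0"
    using F.harmonic_extension[OF fin pos, of "\<lambda>v. a \<bullet> p v"] by blast
  have "form E (weight \<epsilon> c) (\<lambda>v. a \<bullet> p v + z v) y = 0" if y: "vanishing y" for y
  proof -
    \<comment> \<open>Truncating \<open>y\<close> to the free vertices changes nothing that the
      energy sees.\<close>
    have "form E (weight \<epsilon> c) (\<lambda>v. a \<bullet> p v + z v) y =
        form E (weight \<epsilon> c) (\<lambda>v. a \<bullet> p v + z v) (\<lambda>v. if v \<in> ?A then y v else 0)"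
      using y by (intro form_cong_V) (auto simp: vanishing_def)
    then show ?thesis using z(2) by auto
  qed
  moreover have "\<forall>v\<in>B. a \<bullet> p v + z v = a \<bullet> p v" using z(1) by auto
  ultimately show ?thesis
    unfolding harmonic_def by (intro exI[of _ "\<lambda>v. a \<bullet> p v + z v"]) blast
qed

text \<open>Dirichlet's principle: the difference to a competitor vanishes on \<open>B\<close>, so
  it is orthogonal to \<open>x\<close> and only adds its own nonnegative energy.\<close>

lemma harmonic_min:
  assumes "definite \<epsilon> c" "harmonic \<epsilon> c a x" "\<And>v. v \<in> B \<Longrightarrow> y v = a \<bullet> p v"
  shows "form E (weight \<epsilon> c) x x \<le> form E (weight \<epsilon> c) y y"
proof -
  interpret F: sym_bilinear_form "form E (weight \<epsilon> c)" by (rule edge_form_bilinear)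
  define z where "z = (\<lambda>v. y v - x v)"
  have "vanishing z" using assms by (simp add: z_def vanishing_def harmonic_def)
  then have "form E (weight \<epsilon> c) x z = 0" "form E (weight \<epsilon> c) z z \<ge> 0"
    using assms by (auto simp: harmonic_def definite_def)
  then show ?thesis using F.square_add[of x z] by (simp add: z_def)
qed

lemma harmonic_add:
  assumes "harmonic \<epsilon> c a x" "harmonic \<epsilon> c b y"
  shows "harmonic \<epsilon> c (a + b) (\<lambda>v. x v + y v)"
  using assms unfolding harmonic_def by (simp add: inner_add_left edge_form_add)

lemma harmonic_diff:
  assumes "harmonic \<epsilon> c a x" "harmonic \<epsilon> c b y"
  shows "harmonic \<epsilon> c (a - b) (\<lambda>v. x v - y v)"
  using assms sym_bilinear_form.diff[OF edge_form_bilinear, of s t E "weight \<epsilon> c" x y]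
  unfolding harmonic_def by (simp add: inner_diff_left)

text \<open>With z = x - a . p, harmonicity gives E(z, z) = - E(a . p, z). The left side is coercive
  and the right side linear in z with small coefficients, so both are of order
  \<open>\<epsilon> + \<kappa>\<^sup>2\<close>. The energy of x is that of a . p plus E(a . p, z),
  hence equals its first-order term up to the same order.\<close>

lemma estimates:
  "\<exists>C>0. \<exists>\<kappa>\<^sub>0>0. \<exists>\<epsilon>\<^sub>0>0. \<forall>\<epsilon> c \<kappa>. 0 < \<epsilon> \<and> \<epsilon> \<le> \<epsilon>\<^sub>0 \<and> 0 \<le> \<kappa> \<and> \<kappa> \<le> \<kappa>\<^sub>0 \<and> (\<forall>e\<in>M. \<bar>c e\<bar> \<le> \<kappa>) \<longrightarrow>
     definite \<epsilon> c \<and>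
     (\<forall>a x. norm a \<le> 2 \<and> harmonic \<epsilon> c a x \<longrightarrow>
        (size_V (\<lambda>v. x v - a \<bullet> p v))\<^sup>2 \<le> C * (\<epsilon> + \<kappa>\<^sup>2) \<and>
        \<bar>form E (weight \<epsilon> c) x x - form M c (\<lambda>v. a \<bullet> p v) (\<lambda>v. a \<bullet> p v)\<bar> \<le> C * (\<epsilon> + \<kappa>\<^sup>2))"
proof -
  obtain \<delta> \<kappa>\<^sub>0 \<epsilon>\<^sub>0 where pos: "\<delta> > 0" "\<kappa>\<^sub>0 > 0" "\<epsilon>\<^sub>0 > 0"
    and coer: "\<And>\<epsilon> c x. 0 < \<epsilon> \<Longrightarrow> \<epsilon> \<le> \<epsilon>\<^sub>0 \<Longrightarrow> (\<forall>e\<in>M. \<bar>c e\<bar> \<le> \<kappa>\<^sub>0) \<Longrightarrow> vanishing x \<Longrightarrow>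
       \<delta> * (size_V x)\<^sup>2 + (size_I x)\<^sup>2 / (2 * \<epsilon>) \<le> form E (weight \<epsilon> c) x x"
    using coercive_weight by blast
  obtain K where K: "K \<ge> 0"
    and all: "\<forall>\<epsilon> c \<kappa> a z. 0 < \<epsilon> \<and> 0 \<le> \<kappa> \<and> (\<forall>e\<in>M. \<bar>c e\<bar> \<le> \<kappa>) \<and> norm a \<le> 2 \<longrightarrow>
     \<bar>form E (weight \<epsilon> c) (\<lambda>v. a \<bullet> p v) z\<bar> \<le> K * (size_I z + (\<kappa> + \<epsilon>) * size_V z)
     \<and> form other_edges (\<lambda>_. 1) (\<lambda>v. a \<bullet> p v) (\<lambda>v. a \<bullet> p v) \<le> K
     \<and> form E (weight \<epsilon> c) (\<lambda>v. a \<bullet> p v) (\<lambda>v. a \<bullet> p v) =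
         form M c (\<lambda>v. a \<bullet> p v) (\<lambda>v. a \<bullet> p v) + \<epsilon> * form other_edges (\<lambda>_. 1) (\<lambda>v. a \<bullet> p v) (\<lambda>v. a \<bullet> p v)"
    using cross_bound by blast
  have cross: "\<bar>form E (weight \<epsilon> c) (\<lambda>v. a \<bullet> p v) z\<bar> \<le> K * (size_I z + (\<kappa> + \<epsilon>) * size_V z)"
    and other: "form other_edges (\<lambda>_. 1) (\<lambda>v. a \<bullet> p v) (\<lambda>v. a \<bullet> p v) \<le> K"
    and diag: "form E (weight \<epsilon> c) (\<lambda>v. a \<bullet> p v) (\<lambda>v. a \<bullet> p v) =
         form M c (\<lambda>v. a \<bullet> p v) (\<lambda>v. a \<bullet> p v) + \<epsilon> * form other_edges (\<lambda>_. 1) (\<lambda>v. a \<bullet> p v) (\<lambda>v. a \<bullet> p v)"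
    if "0 < \<epsilon>" "0 \<le> \<kappa>" "\<forall>e\<in>M. \<bar>c e\<bar> \<le> \<kappa>" "norm a \<le> 2" for \<epsilon> c \<kappa> a z
    using all[rule_format, of \<epsilon> \<kappa> c a z] that by auto
  define L where "L = K\<^sup>2 * (1 + 1 / \<delta>)"
  have L: "L \<ge> 0" using pos by (simp add: L_def)
  define C where "C = L * (2 / \<delta>) + 2 * L + K + 1"
  have C: "C > 0" "L * (2 / \<delta>) \<le> C" "2 * L + K \<le> C" using L K pos by (simp_all add: C_def add_nonneg_pos)
  show ?thesis
  proof (rule exI[of _ C], rule conjI[OF C(1)], rule exI[of _ \<kappa>\<^sub>0], rule conjI[OF pos(2)],
      rule exI[of _ "min \<epsilon>\<^sub>0 1"], intro conjI allI impI)
    show "0 < min \<epsilon>\<^sub>0 1" using pos by simp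
  next
    fix \<epsilon> \<kappa> :: real and c :: "'e \<Rightarrow> real"
    assume "0 < \<epsilon> \<and> \<epsilon> \<le> min \<epsilon>\<^sub>0 1 \<and> 0 \<le> \<kappa> \<and> \<kappa> \<le> \<kappa>\<^sub>0 \<and> (\<forall>e\<in>M. \<bar>c e\<bar> \<le> \<kappa>)"
    then have \<epsilon>: "0 < \<epsilon>" "\<epsilon> \<le> \<epsilon>\<^sub>0" "\<epsilon> \<le> 1" and \<kappa>: "0 \<le> \<kappa>" "\<kappa> \<le> \<kappa>\<^sub>0" and c: "\<forall>e\<in>M. \<bar>c e\<bar> \<le> \<kappa>" by auto
    have c0: "\<forall>e\<in>M. \<bar>c e\<bar> \<le> \<kappa>\<^sub>0" using c \<kappa> by force
    let ?E = "form E (weight \<epsilon> c)"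
    note coer' = coer[OF \<epsilon>(1,2) c0]
    show "definite \<epsilon> c"
      unfolding definite_def
    proof (intro allI impI conjI ballI)
      fix z assume z: "vanishing z"
      have i0: "(size_I z)\<^sup>2 / (2 * \<epsilon>) \<ge> 0" using \<epsilon>(1) by simp
      have n0: "\<delta> * (size_V z)\<^sup>2 \<ge> 0" using pos by simp
      show "0 \<le> ?E z z" using coer'[OF z] i0 n0 by linarith
      show "z v = 0" if "?E z z = 0" "v \<in> V" for v
      proof -
        have "\<delta> * (size_V z)\<^sup>2 \<le> 0" using coer'[OF z] i0 that(1) by linarith
        then have "size_V z = 0" using pos(1) by (simp add: mult_le_0_iff)
        then show ?thesis using abs_le_size_V[OF that(2), of z] by simp
      qed
    qed
    fix a :: "real ^ 'd" and x assume "norm a \<le> 2 \<and> harmonic \<epsilon> c a x"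
    then have a: "norm a \<le> 2" and x: "harmonic \<epsilon> c a x" by auto
    interpret F: sym_bilinear_form ?E by (rule edge_form_bilinear)
    let ?P = "\<lambda>v. a \<bullet> p v"
    define z where "z = (\<lambda>v. x v - a \<bullet> p v)"
    have xz: "x = (\<lambda>v. a \<bullet> p v + z v)" by (simp add: z_def)
    have z: "vanishing z" using x by (simp add: vanishing_def harmonic_def z_def)
    have "?E x z = 0" using x z by (simp add: harmonic_def)
    then have xz0: "?E ?P z + ?E z z = 0" unfolding xz F.add .
    have xx: "?E x x = ?E ?P ?P + ?E ?P z"
      using F.square_add[of ?P z] xz0 unfolding xz by simp
    define i where "i = size_I z"
    define n where "n = size_V z"
    define \<beta> where "\<beta> = \<kappa> + \<epsilon>"
    \<comment> \<open>What remains of the cross term after two applications of Young's inequality,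
      each absorbing half of one coercive term.\<close>
    define Q where "Q = K\<^sup>2 * \<epsilon> + K\<^sup>2 * \<beta>\<^sup>2 / (2 * \<delta>)"
    have cr: "\<bar>?E ?P z\<bar> \<le> K * (i + \<beta> * n)" unfolding i_def n_def \<beta>_def by (rule cross[OF \<epsilon>(1) \<kappa>(1) c a])
    have "K * i \<le> i\<^sup>2 / (4 * \<epsilon>) + K\<^sup>2 * \<epsilon>"
    proof -
      have "0 \<le> (i - 2 * K * \<epsilon>)\<^sup>2 / (4 * \<epsilon>)" using \<epsilon> by simp
      also have "\<dots> = i\<^sup>2 / (4 * \<epsilon>) + K\<^sup>2 * \<epsilon> - K * i" using \<epsilon>(1) by (simp add: field_simps power2_eq_square)
      finally show ?thesis by simp
    qed
    moreover have "K * (\<beta> * n) \<le> \<delta> * n\<^sup>2 / 2 + K\<^sup>2 * \<beta>\<^sup>2 / (2 * \<delta>)"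
    proof -
      have "0 \<le> (\<delta> * n - K * \<beta>)\<^sup>2 / (2 * \<delta>)" using pos by simp
      also have "\<dots> = \<delta> * n\<^sup>2 / 2 + K\<^sup>2 * \<beta>\<^sup>2 / (2 * \<delta>) - K * (\<beta> * n)"
        using pos(1) by (simp add: field_simps power2_eq_square)
      finally show ?thesis by simp
    qed
    ultimately have young: "K * (i + \<beta> * n) \<le> i\<^sup>2 / (4 * \<epsilon>) + \<delta> * n\<^sup>2 / 2 + Q"
      unfolding Q_def by (simp add: distrib_left)
    have "\<delta> * n\<^sup>2 + i\<^sup>2 / (2 * \<epsilon>) \<le> ?E z z" unfolding n_def i_def by (rule coer'[OF z])
    moreover have "i\<^sup>2 / (2 * \<epsilon>) = i\<^sup>2 / (4 * \<epsilon>) + i\<^sup>2 / (4 * \<epsilon>)" using \<epsilon>(1) by (simp add: field_simps)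
    ultimately have small: "\<delta> * n\<^sup>2 / 2 + i\<^sup>2 / (4 * \<epsilon>) \<le> Q" using xz0 cr young by linarith
    have "\<beta>\<^sup>2 \<le> 2 * \<kappa>\<^sup>2 + 2 * \<epsilon>\<^sup>2" unfolding \<beta>_def by (rule square_add_le)
    also have "\<epsilon>\<^sup>2 \<le> \<epsilon>" using \<epsilon> by (simp add: power2_eq_square mult_left_le)
    finally have \<beta>2: "\<beta>\<^sup>2 \<le> 2 * (\<epsilon> + \<kappa>\<^sup>2)" by simp
    have "Q \<le> K\<^sup>2 * (\<epsilon> + \<kappa>\<^sup>2) + K\<^sup>2 * (2 * (\<epsilon> + \<kappa>\<^sup>2)) / (2 * \<delta>)"
      unfolding Q_def using pos(1) \<beta>2 by (intro add_mono mult_left_mono divide_right_mono) auto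
    also have "\<dots> = L * (\<epsilon> + \<kappa>\<^sup>2)" using pos(1) by (simp add: L_def field_simps)
    finally have QL: "Q \<le> L * (\<epsilon> + \<kappa>\<^sup>2)" .
    have ek: "0 \<le> \<epsilon> + \<kappa>\<^sup>2" using \<epsilon> by simp
    have i0: "0 \<le> i\<^sup>2 / (4 * \<epsilon>)" using \<epsilon> by simp
    show "(size_V (\<lambda>v. x v - a \<bullet> p v))\<^sup>2 \<le> C * (\<epsilon> + \<kappa>\<^sup>2)"
    proof -
      have "\<delta> * n\<^sup>2 / 2 \<le> L * (\<epsilon> + \<kappa>\<^sup>2)" using small QL i0 by linarith
      then have "n\<^sup>2 \<le> L * (2 / \<delta>) * (\<epsilon> + \<kappa>\<^sup>2)" using pos(1) by (simp add: field_simps)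
      also have "\<dots> \<le> C * (\<epsilon> + \<kappa>\<^sup>2)" using C(2) ek by (rule mult_right_mono)
      finally show ?thesis by (simp add: n_def z_def)
    qed
    have o0: "0 \<le> \<epsilon> * form other_edges (\<lambda>_. 1) ?P ?P" using form_other_nonneg[of ?P] \<epsilon> by simp
    have o1: "\<epsilon> * form other_edges (\<lambda>_. 1) ?P ?P \<le> K * \<epsilon>"
      using other[OF \<epsilon>(1) \<kappa>(1) c a] \<epsilon>(1) by (simp add: mult.commute)
    have "\<bar>?E x x - form M c ?P ?P\<bar> \<le> 2 * (L * (\<epsilon> + \<kappa>\<^sup>2)) + K * \<epsilon>"
      unfolding xx diag[OF \<epsilon>(1) \<kappa>(1) c a] using o0 o1 cr young small QL by linarith
    also have "\<dots> \<le> 2 * (L * (\<epsilon> + \<kappa>\<^sup>2)) + K * (\<epsilon> + \<kappa>\<^sup>2)" using K by (intro add_left_mono mult_left_mono) auto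
    also have "\<dots> = (2 * L + K) * (\<epsilon> + \<kappa>\<^sup>2)" by (simp add: algebra_simps)
    also have "\<dots> \<le> C * (\<epsilon> + \<kappa>\<^sup>2)" using C(3) ek by (rule mult_right_mono)
    finally show "\<bar>?E x x - form M c ?P ?P\<bar> \<le> C * (\<epsilon> + \<kappa>\<^sup>2)" .
  qed
qed

end

section \<open>The fixed point\<close>

lemma edge_form_weight_combination:
  "edge_form s t E (\<lambda>e. a * w e + b * w' e) x y = a * edge_form s t E w x y + b * edge_form s t E w' x y"
  unfolding edge_form_def sum_distrib_left sum.distrib[symmetric]
  by (intro sum.cong refl) (simp add: algebra_simps)

context contraction
begin

text \<open>The weights are affine but not linear in \<open>X\<close>, because of the constants 1 /
  \<epsilon>, \<omega> and \<epsilon>; hence the coefficients must sum to 1.\<close>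

lemma weight_combination:
  assumes "linear (\<lambda>X. T X e)" "u + v = 1"
  shows "weight \<epsilon> (T (u *\<^sub>R X + v *\<^sub>R Y)) e = u * weight \<epsilon> (T X) e + v * weight \<epsilon> (T Y) e"
proof -
  have T: "T (u *\<^sub>R X + v *\<^sub>R Y) e = u * T X e + v * T Y e"
    using linear_add[OF assms(1)] linear_scale[OF assms(1)] by simp
  have v: "v = 1 - u" using assms(2) by simp
  show ?thesis unfolding weight_def T unfolding v by (simp add: algebra_simps diff_divide_distrib)
qed

lemma harmonic_unique_value:
  assumes "definite \<epsilon> c" "harmonic \<epsilon> c a x" "harmonic \<epsilon> c a y"
  shows "form E (weight \<epsilon> c) x x = form E (weight \<epsilon> c) y y"
  using harmonic_min[OF assms(1,2), of y] harmonic_min[OF assms(1,3), of x] assms(2,3)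
  by (simp add: harmonic_def)

text \<open>Estimates and concavity concern the energy of a single harmonic function; this transfers
  them to mixed energies. The choice \<open>h\<close> need not be linear, so exchanging
  \<open>h (a + b)\<close> for the sum rests on uniqueness of the minimal energy.\<close>

lemma harmonic_polarization:
  assumes "definite \<epsilon> c" "\<And>a. harmonic \<epsilon> c a (h a)"
  shows "form E (weight \<epsilon> c) (h a) (h b) =
    (form E (weight \<epsilon> c) (h (a + b)) (h (a + b)) - form E (weight \<epsilon> c) (h (a - b)) (h (a - b))) / 4"
proof -
  interpret F: sym_bilinear_form "form E (weight \<epsilon> c)" by (rule edge_form_bilinear)
  have "form E (weight \<epsilon> c) (h (a + b)) (h (a + b)) =
      form E (weight \<epsilon> c) (\<lambda>v. h a v + h b v) (\<lambda>v. h a v + h b v)"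
    by (rule harmonic_unique_value[OF assms(1,2) harmonic_add]) (rule assms(2))+
  moreover have "form E (weight \<epsilon> c) (h (a - b)) (h (a - b)) =
      form E (weight \<epsilon> c) (\<lambda>v. h a v - h b v) (\<lambda>v. h a v - h b v)"
    by (rule harmonic_unique_value[OF assms(1,2) harmonic_diff]) (rule assms(2))+
  ultimately show ?thesis
    by (simp add: F.square_add F.diff F.diff_right F.sym[of "h b" "h a"])
qed

text \<open>The minimal energy is an infimum of functions that are affine in \<open>X\<close>, hence concave in \<open>X\<close>.\<close>

lemma continuous_minimal_energy:
  assumes T: "\<And>e. linear (\<lambda>X :: real ^ 'd ^ 'd. T X e)"
    and S: "open S" "convex S"
    and def: "\<And>X. X \<in> S \<Longrightarrow> definite \<epsilon> (T X)"
    and h: "\<And>X. X \<in> S \<Longrightarrow> harmonic \<epsilon> (T X) a (h X)"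
  shows "continuous_on S (\<lambda>X. form E (weight \<epsilon> (T X)) (h X) (h X))"
proof -
  let ?f = "\<lambda>X. form E (weight \<epsilon> (T X)) (h X) (h X)"
  have "convex_on S (\<lambda>X. - ?f X)"
  proof (rule convex_onI)
    fix u X Y assume u: "0 < u" "u < (1 :: real)" and X: "X \<in> S" and Y: "Y \<in> S"
    let ?Z = "(1 - u) *\<^sub>R X + u *\<^sub>R Y"
    have Z: "?Z \<in> S" using convexD_alt[OF S(2) X Y] u by simp
    have w: "weight \<epsilon> (T ?Z) = (\<lambda>e. (1 - u) * weight \<epsilon> (T X) e + u * weight \<epsilon> (T Y) e)"
      using weight_combination[OF T] by fastforce
    \<comment> \<open>The minimizer at the intermediate matrix is an admissible competitor at both
      end points.\<close>
    have zB: "h ?Z v = a \<bullet> p v" if "v \<in> B" for v using h[OF Z] that by (simp add: harmonic_def)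
    have "(1 - u) * ?f X + u * ?f Y \<le>
        (1 - u) * form E (weight \<epsilon> (T X)) (h ?Z) (h ?Z) + u * form E (weight \<epsilon> (T Y)) (h ?Z) (h ?Z)"
      using u harmonic_min[OF def[OF X] h[OF X] zB] harmonic_min[OF def[OF Y] h[OF Y] zB]
      by (intro add_mono mult_left_mono) auto
    also have "\<dots> = ?f ?Z" unfolding w edge_form_weight_combination ..
    finally show "- ?f ?Z \<le> (1 - u) * - ?f X + u * - ?f Y" by simp
  qed (rule S)
  \<comment> \<open>Convex functions on an open convex set of finite dimension are
    continuous.\<close>
  then have "continuous_on S (\<lambda>X. - (- ?f X))"
    by (intro continuous_on_minus convex_on_continuous S)
  then show ?thesis by simp
qed

text \<open>All that super stability asks of a realization on \<open>E\<close>, except for the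
  signs, which may simply follow the nonzero weights.\<close>

lemma super_stable_data:
  "\<exists>w (p' :: 'v \<Rightarrow> real ^ 'd). (\<forall>e\<in>E. w e \<noteq> 0) \<and> affine hull (p' ` V) = UNIV \<and>
    (\<forall>k x. form E w x (\<lambda>v. p' v $ k) = 0) \<and> (\<forall>x. form E w x x \<ge> 0) \<and>
    (\<forall>y. (\<forall>x. form E w x y = 0) \<longrightarrow> (\<exists>a b. \<forall>v\<in>V. y v = b + a \<bullet> p' v)) \<and>
    (\<forall>S. transpose S = S \<longrightarrow> (\<forall>e\<in>E. (p' (s e) - p' (t e)) \<bullet> (S *v (p' (s e) - p' (t e))) = 0) \<longrightarrow> S = 0)"
proof -
  obtain C \<kappa>\<^sub>0 \<epsilon>\<^sub>0 where C: "C > 0" and \<kappa>\<^sub>0: "\<kappa>\<^sub>0 > 0" and \<epsilon>\<^sub>0: "\<epsilon>\<^sub>0 > 0"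
    and est: "\<forall>\<epsilon> c \<kappa>. 0 < \<epsilon> \<and> \<epsilon> \<le> \<epsilon>\<^sub>0 \<and> 0 \<le> \<kappa> \<and> \<kappa> \<le> \<kappa>\<^sub>0 \<and> (\<forall>e\<in>M. \<bar>c e\<bar> \<le> \<kappa>) \<longrightarrow>
     definite \<epsilon> c \<and>
     (\<forall>a x. norm a \<le> 2 \<and> harmonic \<epsilon> c a x \<longrightarrow>
        (size_V (\<lambda>v. x v - a \<bullet> p v))\<^sup>2 \<le> C * (\<epsilon> + \<kappa>\<^sup>2) \<and>
        \<bar>form E (weight \<epsilon> c) x x - form M c (\<lambda>v. a \<bullet> p v) (\<lambda>v. a \<bullet> p v)\<bar> \<le> C * (\<epsilon> + \<kappa>\<^sup>2))"
    using estimates by blast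
  obtain T A where T_lin: "\<forall>e. linear (\<lambda>X. T X e)"
    and T: "\<forall>X k l. transpose X = X \<longrightarrow> (\<Sum>e\<in>M. T X e * (edge_vec e $ k * edge_vec e $ l)) = X $ k $ l"
    and A: "A > 0" "\<forall>X. \<forall>e\<in>M. \<bar>T X e\<bar> \<le> A * norm X"
    by (rule rigid_coordinates)
  obtain \<eta> where \<eta>: "\<eta> > 0"
    and rigid': "\<And>(p' :: 'v \<Rightarrow> real ^ 'd) S. (\<forall>v\<in>V. \<forall>k. \<bar>p' v $ k - p v $ k\<bar> \<le> \<eta>) \<Longrightarrow>
      transpose S = S \<Longrightarrow> (\<forall>e\<in>M. (p' (s e) - p' (t e)) \<bullet> (S *v (p' (s e) - p' (t e))) = 0) \<Longrightarrow> S = 0"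
    using rigid_perturbed by blast
  \<comment> \<open>A lower bound for the stress on \<open>M\<close>; the inserted 1 covers empty
    \<open>M\<close>.\<close>
  define \<mu> where "\<mu> = Min (insert 1 ((\<lambda>e. \<bar>\<omega> e\<bar>) ` M))"
  have \<mu>: "\<mu> > 0" "\<And>e. e \<in> M \<Longrightarrow> \<mu> \<le> \<bar>\<omega> e\<bar>"
    using finite_parts(2) \<omega>_nonzero unfolding \<mu>_def by (auto simp: Min_gr_iff)
  define N where "N = (real CARD('d))\<^sup>2"
  have N: "N > 0" by (simp add: N_def)
  \<comment> \<open>In this order: corrections stay in the range of the estimates, they stay below
    the stress of the minor, the quadratic error is at most \<rho> / 2, and the points move by at
    most \<eta>.\<close>
  define \<rho> where "\<rho> = Min {\<kappa>\<^sub>0 / (2 * A), \<mu> / (2 * A), 1 / (2 * N * C * A\<^sup>2), \<eta>\<^sup>2 * N}"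
  have \<rho>: "\<rho> > 0" and "\<rho> \<le> \<kappa>\<^sub>0 / (2 * A)" "\<rho> \<le> \<mu> / (2 * A)" "\<rho> \<le> 1 / (2 * N * C * A\<^sup>2)" and \<rho>\<eta>: "\<rho> \<le> \<eta>\<^sup>2 * N"
    using \<kappa>\<^sub>0 \<mu> A N C \<eta> by (auto simp: \<rho>_def)
  then have \<rho>\<kappa>: "A * (2 * \<rho>) \<le> \<kappa>\<^sub>0" and \<rho>\<mu>: "A * (2 * \<rho>) \<le> \<mu>" and "\<rho> * (2 * N * C * A\<^sup>2) \<le> 1"
    using A N C by (simp_all add: pos_le_divide_eq mult_ac)
  then have "\<rho> * (\<rho> * (2 * N * C * A\<^sup>2)) \<le> \<rho> * 1" using \<rho> by (intro mult_left_mono) auto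
  then have \<rho>2: "N * (C * (A * \<rho>)\<^sup>2) \<le> \<rho> / 2" by (simp add: power2_eq_square mult_ac)
  have A\<rho>: "0 < A * \<rho>" "A * (2 * \<rho>) = 2 * (A * \<rho>)" using A(1) \<rho> by simp_all
  \<comment> \<open>Makes the error caused by \<epsilon> the other half of \<rho>.\<close>
  define \<epsilon> where "\<epsilon> = min \<epsilon>\<^sub>0 (\<rho> / (2 * N * C))"
  have \<epsilon>: "\<epsilon> > 0" "\<epsilon> \<le> \<epsilon>\<^sub>0" using \<epsilon>\<^sub>0 \<rho> N C by (auto simp: \<epsilon>_def)
  have "\<epsilon> \<le> \<rho> / (2 * N * C)" by (simp add: \<epsilon>_def)
  then have "N * (C * \<epsilon>) \<le> \<rho> / 2" using N C by (simp add: pos_le_divide_eq mult_ac)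
  with \<rho>2 have err: "N * (C * (\<epsilon> + (A * \<rho>)\<^sup>2)) \<le> \<rho>" by (simp add: distrib_left)
  \<comment> \<open>An open neighbourhood of the closed ball of radius \<rho>, since concavity
    yields continuity only on open sets.\<close>
  define S where "S = ball (0 :: real ^ 'd ^ 'd) (2 * \<rho>)"
  have def: "definite \<epsilon> (T X)" if X: "X \<in> S" for X
  proof -
    have "\<bar>T X e\<bar> \<le> A * (2 * \<rho>)" if "e \<in> M" for e
    proof -
      have "\<bar>T X e\<bar> \<le> A * norm X" using A(2) that by blast
      also have "\<dots> \<le> A * (2 * \<rho>)" using A(1) X by (simp add: S_def)
      finally show ?thesis .
    qed
    then show ?thesis
      using est[rule_format, of \<epsilon> "A * (2 * \<rho>)" "T X"] \<epsilon> \<rho>\<kappa> A(1) \<rho> by simp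
  qed
  define h where "h X a = (SOME x. harmonic \<epsilon> (T X) a x)" for X a
  have h: "harmonic \<epsilon> (T X) a (h X a)" if "X \<in> S" for X a
    unfolding h_def by (rule someI_ex[OF harmonic_exists[OF def[OF that]]])
  define E\<^sub>X where "E\<^sub>X X = form E (weight \<epsilon> (T X))" for X
  define F :: "real ^ 'd ^ 'd \<Rightarrow> real ^ 'd ^ 'd" where
    "F X = (\<chi> k l. E\<^sub>X X (h X (axis k 1)) (h X (axis l 1)))" for X
  have F_polar: "F X $ k $ l = (E\<^sub>X X (h X (axis k 1 + axis l 1)) (h X (axis k 1 + axis l 1)) -
      E\<^sub>X X (h X (axis k 1 - axis l 1)) (h X (axis k 1 - axis l 1))) / 4" if "X \<in> S" for X k l
    unfolding F_def E\<^sub>X_def using harmonic_polarization[OF def[OF that] h[OF that]] by simp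
  define K where "K = {X :: real ^ 'd ^ 'd. transpose X = X} \<inter> cball 0 \<rho>"
  have KS: "K \<subseteq> S" using \<rho> by (auto simp: K_def S_def)
  have K_bound: "\<forall>e\<in>M. \<bar>T X e\<bar> \<le> A * \<rho>" if "X \<in> K" for X
  proof
    fix e assume "e \<in> M"
    then have "\<bar>T X e\<bar> \<le> A * norm X" using A(2) by blast
    also have "\<dots> \<le> A * \<rho>" using that A(1) by (simp add: K_def)
    finally show "\<bar>T X e\<bar> \<le> A * \<rho>" .
  qed
  have K_est: "(size_V (\<lambda>v. h X a v - a \<bullet> p v))\<^sup>2 \<le> C * (\<epsilon> + (A * \<rho>)\<^sup>2)"
      "\<bar>E\<^sub>X X (h X a) (h X a) - form M (T X) (\<lambda>v. a \<bullet> p v) (\<lambda>v. a \<bullet> p v)\<bar> \<le> C * (\<epsilon> + (A * \<rho>)\<^sup>2)"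
    if X: "X \<in> K" and a: "norm a \<le> 2" for X a
  proof -
    have "A * \<rho> \<le> \<kappa>\<^sub>0" "0 \<le> A * \<rho>" using \<rho>\<kappa> A\<rho> by linarith+
    then have "\<forall>a x. norm a \<le> 2 \<and> harmonic \<epsilon> (T X) a x \<longrightarrow>
        (size_V (\<lambda>v. x v - a \<bullet> p v))\<^sup>2 \<le> C * (\<epsilon> + (A * \<rho>)\<^sup>2) \<and>
        \<bar>form E (weight \<epsilon> (T X)) x x - form M (T X) (\<lambda>v. a \<bullet> p v) (\<lambda>v. a \<bullet> p v)\<bar> \<le> C * (\<epsilon> + (A * \<rho>)\<^sup>2)"
      using est[rule_format, of \<epsilon> "A * \<rho>" "T X"] \<epsilon> K_bound[OF X] by blast
    then show "(size_V (\<lambda>v. h X a v - a \<bullet> p v))\<^sup>2 \<le> C * (\<epsilon> + (A * \<rho>)\<^sup>2)"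
      "\<bar>E\<^sub>X X (h X a) (h X a) - form M (T X) (\<lambda>v. a \<bullet> p v) (\<lambda>v. a \<bullet> p v)\<bar> \<le> C * (\<epsilon> + (A * \<rho>)\<^sup>2)"
      using a h[of X a] X KS unfolding E\<^sub>X_def by blast+
  qed
  have F_close: "norm (X - F X) \<le> \<rho>" if X: "X \<in> K" for X
  proof -
    have "\<bar>(X - F X) $ k $ l\<bar> \<le> C * (\<epsilon> + (A * \<rho>)\<^sup>2)" for k l
    proof -
      interpret Q: sym_bilinear_form "form M (T X)" by (rule edge_form_bilinear)
      let ?a = "axis k 1 :: real ^ 'd" and ?b = "axis l 1 :: real ^ 'd"
      let ?P = "\<lambda>a v. a \<bullet> p v"
      have n: "norm (?a + ?b) \<le> 2" "norm (?a - ?b) \<le> 2"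
        using norm_triangle_ineq[of ?a ?b] norm_triangle_ineq4[of ?a ?b] by simp_all
      \<comment> \<open>The first-order term reproduces \<open>X\<close> exactly, so
        \<open>X - F X\<close> consists of the errors of two diagonal energies.\<close>
      have "form M (T X) (?P ?a) (?P ?b) = (\<Sum>e\<in>M. T X e * (edge_vec e $ k * edge_vec e $ l))"
        unfolding edge_form_def edge_vec_def by (simp add: inner_axis' mult.assoc)
      also have "\<dots> = X $ k $ l" using T X by (auto simp: K_def)
      finally have Xkl: "form M (T X) (?P (?a + ?b)) (?P (?a + ?b)) - form M (T X) (?P (?a - ?b)) (?P (?a - ?b))
          = 4 * X $ k $ l"
        using Q.sym[of "?P ?b" "?P ?a"]
        by (simp only: inner_add_left inner_diff_left Q.add Q.add_right Q.diff Q.diff_right)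
      have "4 * \<bar>(X - F X) $ k $ l\<bar> = \<bar>4 * X $ k $ l - 4 * F X $ k $ l\<bar>"
        unfolding right_diff_distrib[symmetric] abs_mult by simp
      also have "\<dots> \<le> 2 * (C * (\<epsilon> + (A * \<rho>)\<^sup>2))"
        unfolding Xkl[symmetric] using F_polar[of X k l] X KS K_est(2)[OF X n(1)] K_est(2)[OF X n(2)]
        by (simp add: subset_iff)
      finally show ?thesis by linarith
    qed
    then have "norm (X - F X) \<le> N * (C * (\<epsilon> + (A * \<rho>)\<^sup>2))" unfolding N_def by (rule norm_le_entries)
    then show ?thesis using err by linarith
  qed
  have "continuous_on S F"
    unfolding F_def
  proof (intro continuous_on_vec_lambda)
    fix k l :: 'd
    have cont: "continuous_on S (\<lambda>X. E\<^sub>X X (h X a) (h X a))" for a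
      unfolding E\<^sub>X_def using T_lin def h
      by (intro continuous_minimal_energy) (auto simp: S_def)
    have "continuous_on S (\<lambda>X. (E\<^sub>X X (h X (axis k 1 + axis l 1)) (h X (axis k 1 + axis l 1)) -
      E\<^sub>X X (h X (axis k 1 - axis l 1)) (h X (axis k 1 - axis l 1))) / 4)"
      by (intro continuous_intros cont) auto
    then show "continuous_on S (\<lambda>X. E\<^sub>X X (h X (axis k 1)) (h X (axis l 1)))"
      by (rule continuous_on_eq) (use F_polar in \<open>simp add: F_def\<close>)
  qed
  then have contK: "continuous_on K (\<lambda>X. X - F X)"
    using KS by (intro continuous_intros) (rule continuous_on_subset)
  have F_sym: "transpose (F X) = F X" for X
    by (simp add: F_def transpose_def vec_eq_iff E\<^sub>X_def edge_form_sym)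
  have "compact K"
    unfolding K_def by (intro closed_Int_compact closed_subspace subspace_symmetric compact_cball)
  moreover have "convex K"
    unfolding K_def by (intro convex_Int subspace_imp_convex subspace_symmetric convex_cball)
  moreover have "0 \<in> K" using \<rho> by (simp add: K_def transpose_def vec_eq_iff)
  moreover have "(\<lambda>X. X - F X) \<in> K \<rightarrow> K"
  proof
    fix X assume X: "X \<in> K"
    have "transpose (X - F X) = X - F X"
      using X F_sym[of X] subspace_diff[OF subspace_symmetric, of X "F X"] by (simp add: K_def)
    then show "X - F X \<in> K" using F_close[OF X] by (simp add: K_def)
  qed
  ultimately obtain X where X: "X \<in> K" "X - F X = X"
    using brouwer[of K "\<lambda>X. X - F X"] contK by blast
  then have F0: "F X = 0" by simp
  have XS: "X \<in> S" using X KS by blast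
  define w where "w = weight \<epsilon> (T X)"
  define p' where "p' v = (\<chi> k. h X (axis k 1) v)" for v
  interpret F: sym_bilinear_form "form E w" by (rule edge_form_bilinear)
  have harm: "harmonic \<epsilon> (T X) (axis k 1) (\<lambda>v. p' v $ k)" for k
    unfolding p'_def using h[OF XS] by simp
  have p'B: "p' v = p v" if "v \<in> B" for v
    using harm that by (simp add: harmonic_def vec_eq_iff inner_axis')
  have orth: "form E w (\<lambda>v. p' v $ k) (\<lambda>v. p' v $ l) = 0" for k l
  proof -
    have "form E w (\<lambda>v. p' v $ k) (\<lambda>v. p' v $ l) = F X $ k $ l"
      by (simp add: F_def p'_def E\<^sub>X_def w_def)
    then show ?thesis by (simp add: F0)
  qed
  \<comment> \<open>Interpolate \<open>y\<close> on the pinned vertices, where \<open>p'\<close>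
    agrees with \<open>p\<close>.\<close>
  have decomp: "\<exists>a b. vanishing (\<lambda>v. y v - (b + a \<bullet> p' v))" for y
    using interpolation[of y] p'B unfolding vanishing_def by fastforce
  \<comment> \<open>Harmonicity kills the vanishing part of \<open>y\<close>, and the zero of
    \<open>F\<close> kills its affine part.\<close>
  have stress': "form E w y (\<lambda>v. p' v $ k) = 0" for y k
  proof -
    obtain a b where ab: "vanishing (\<lambda>v. y v - (b + a \<bullet> p' v))" using decomp by blast
    have "form E w (\<lambda>v. p' v $ k) (\<lambda>v. y v - (b + a \<bullet> p' v)) = 0"
      using harm ab by (simp add: harmonic_def w_def)
    moreover have "form E w (\<lambda>v. p' v $ k) (\<lambda>v. b + a \<bullet> p' v) = 0"
      by (rule edge_form_affine) (rule orth)
    ultimately show ?thesis by (simp add: F.diff_right F.sym)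
  qed
  have aff0: "form E w y (\<lambda>v. b + a \<bullet> p' v) = 0" for y a b
    by (rule edge_form_affine) (rule stress')
  \<comment> \<open>Affine functions of \<open>p'\<close> are now in the radical, so energy and
    kernel are decided by the vanishing part, where \<open>definite\<close> applies.\<close>
  have red: "form E w y y = form E w (\<lambda>v. y v - (b + a \<bullet> p' v)) (\<lambda>v. y v - (b + a \<bullet> p' v))" for y a b
    using aff0[of y b a] aff0[of "\<lambda>v. b + a \<bullet> p' v" b a] F.sym[of "\<lambda>v. b + a \<bullet> p' v" y]
    by (simp add: F.diff F.diff_right)
  have psd': "form E w y y \<ge> 0" for y
  proof -
    obtain a b where ab: "vanishing (\<lambda>v. y v - (b + a \<bullet> p' v))" using decomp by blast
    show ?thesis unfolding red[of y b a] using def[OF XS] ab by (simp add: definite_def w_def)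
  qed
  have ker': "\<exists>a b. \<forall>v\<in>V. y v = b + a \<bullet> p' v" if y: "\<forall>x. form E w x y = 0" for y
  proof -
    obtain a b where ab: "vanishing (\<lambda>v. y v - (b + a \<bullet> p' v))" using decomp by blast
    have "form E w (\<lambda>v. y v - (b + a \<bullet> p' v)) (\<lambda>v. y v - (b + a \<bullet> p' v)) = 0"
      using red[of y b a] y by simp
    then have "\<forall>v\<in>V. y v - (b + a \<bullet> p' v) = 0"
      using def[OF XS] ab unfolding definite_def w_def by blast
    then show ?thesis by auto
  qed
  have w_nonzero: "w e \<noteq> 0" if "e \<in> E" for e
  proof (cases "e \<in> M")
    case True
    have "\<bar>T X e\<bar> \<le> A * \<rho>" using K_bound[OF X(1)] True by blast
    \<comment> \<open>Strict because \<rho> was chosen with a spare factor 2; the correction cannot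
      cancel the stress.\<close>
    moreover have "A * \<rho> < \<mu>" using \<rho>\<mu> A\<rho> by linarith
    ultimately show ?thesis using \<mu>(2)[OF True] M_outer[OF True] True by (auto simp: w_def weight_def)
  qed (use \<epsilon> in \<open>auto simp: w_def weight_def\<close>)
  have "affine hull (p ` B) \<subseteq> affine hull (p' ` V)"
    using p'B B_V by (intro hull_mono) force
  then have hull': "affine hull (p' ` V) = UNIV" using hull_B by auto
  have close: "\<forall>v\<in>V. \<forall>k. \<bar>p' v $ k - p v $ k\<bar> \<le> \<eta>"
  proof (intro ballI allI)
    fix v k assume v: "v \<in> V"
    have "(size_V (\<lambda>v. p' v $ k - p v $ k))\<^sup>2 \<le> C * (\<epsilon> + (A * \<rho>)\<^sup>2)"
      using K_est(1)[OF X(1), of "axis k 1"] by (simp add: p'_def inner_axis')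
    also have "\<dots> \<le> \<eta>\<^sup>2"
    proof -
      have "N * (C * (\<epsilon> + (A * \<rho>)\<^sup>2)) \<le> N * \<eta>\<^sup>2" using err \<rho>\<eta> by (simp add: mult.commute)
      then show ?thesis using N by simp
    qed
    finally have "size_V (\<lambda>v. p' v $ k - p v $ k) \<le> \<eta>" using \<eta> by (simp add: power2_le_iff_abs_le)
    then show "\<bar>p' v $ k - p v $ k\<bar> \<le> \<eta>" using abs_le_size_V[OF v, of "\<lambda>v. p' v $ k - p v $ k"] by simp
  qed
  have "S = 0" if "transpose S = S" "\<forall>e\<in>E. (p' (s e) - p' (t e)) \<bullet> (S *v (p' (s e) - p' (t e))) = 0" for S
    using rigid'[OF close that(1)] that(2) M_E by blast
  then show ?thesis using w_nonzero hull' stress' psd' ker' by (intro exI[of _ w] exI[of _ p']) blast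
qed

end

section \<open>Lifting a realization along a minor\<close>

theorem theorem3p9:
  fixes G :: "('v, 'e) pre_multigraph" and H :: "('w, 'f) pre_multigraph"
  assumes "multigraph G" and "connected_multigraph G"
    and "is_minor H G"
    and "\<exists>(\<sigma> :: 'f \<Rightarrow> sign) (p :: 'w \<Rightarrow> real ^ 'd). super_stable H \<sigma> p"
  shows "\<exists>(\<sigma> :: 'e \<Rightarrow> sign) (p :: 'v \<Rightarrow> real ^ 'd). super_stable G \<sigma> p"
proof -
  obtain \<sigma>\<^sub>H and p\<^sub>H :: "'w \<Rightarrow> real ^ 'd" where stable: "super_stable H \<sigma>\<^sub>H p\<^sub>H" using assms(4) by blast
  \<comment> \<open>The affine hull of the empty set is not the whole space.\<close>
  have "verts H \<noteq> {}" using stable by (auto simp: super_stable_def)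
  then obtain \<phi> \<psi> where model: "minor_model G H (verts G) \<phi> \<psi>"
    using spanning_minor_model assms(1-3) by blast
  note m = minor_modelD[OF model]
  have "\<forall>e. \<exists>a b. ends G e = Upair a b" by (meson uprod_exhaust)
  then obtain s t where st: "\<And>e. ends G e = Upair (s e) (t e)" by metis
  interpret G: oriented_multigraph G s t
    by unfold_locales (use assms(1) st in auto)
  \<comment> \<open>The orientation of \<open>H\<close> is copied from \<open>G\<close>, so that
    energies on \<open>H\<close> and on \<open>M\<close> agree term by term.\<close>
  define s\<^sub>H where "s\<^sub>H = (\<lambda>e. \<phi> (s (\<psi> e)))"
  define t\<^sub>H where "t\<^sub>H = (\<lambda>e. \<phi> (t (\<psi> e)))"
  interpret H: oriented_multigraph H s\<^sub>H t\<^sub>H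
  proof
    show "multigraph H" using multigraph_minor assms by blast
    show "ends H e = Upair (s\<^sub>H e) (t\<^sub>H e)" if "e \<in> edges H" for e
      using m(7)[OF that] by (simp add: st s\<^sub>H_def t\<^sub>H_def)
  qed
  from stable obtain w\<^sub>H where hull_H: "affine hull (p\<^sub>H ` verts H) = UNIV"
    and stress_H: "\<And>k x. H.form w\<^sub>H x (\<lambda>v. p\<^sub>H v $ k) = 0"
    and sign_H: "\<And>e. e \<in> edges H \<Longrightarrow> sign_val (\<sigma>\<^sub>H e) * w\<^sub>H e > 0"
    and psd_H: "\<And>x. H.form w\<^sub>H x x \<ge> 0"
    and kernel_H: "\<And>y. (\<forall>x. H.form w\<^sub>H x y = 0) \<Longrightarrow> (\<exists>a b. \<forall>v\<in>verts H. y v = b + a \<bullet> p\<^sub>H v)"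
    and rigid_H: "\<And>S. transpose S = S \<Longrightarrow>
       (\<forall>e\<in>edges H. (p\<^sub>H (s\<^sub>H e) - p\<^sub>H (t\<^sub>H e)) \<bullet> (S *v (p\<^sub>H (s\<^sub>H e) - p\<^sub>H (t\<^sub>H e))) = 0) \<Longrightarrow> S = 0"
    unfolding H.super_stable_iff by blast
  have "\<forall>w\<in>verts H. \<exists>v\<in>verts G. \<phi> v = w" by (simp flip: m(2)) blast
  then obtain rep where rep: "\<And>w. w \<in> verts H \<Longrightarrow> rep w \<in> verts G" "\<And>w. w \<in> verts H \<Longrightarrow> \<phi> (rep w) = w"
    by metis
  have \<phi>: "\<phi> v \<in> verts H" if "v \<in> verts G" for v using m(2) that by blast
  \<comment> \<open>Replaces each vertex of \<open>H\<close> by one vertex of its branch set, so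
    that the quotient lives inside \<open>G\<close>.\<close>
  define r where "r = rep \<circ> \<phi>"
  define M where "M = \<psi> ` edges H"
  define \<omega> where "\<omega> e = w\<^sub>H (inv_into (edges H) \<psi> e)" for e
  define p where "p = p\<^sub>H \<circ> \<phi>"
  have \<phi>_r: "\<phi> (r v) = \<phi> v" if "v \<in> verts G" for v using rep \<phi>[OF that] by (simp add: r_def)
  have \<omega>: "\<omega> (\<psi> e) = w\<^sub>H e" if "e \<in> edges H" for e using m(4) that by (simp add: \<omega>_def)
  have M_form: "edge_form s t M \<omega> (x \<circ> \<phi>) (y \<circ> \<phi>) = H.form w\<^sub>H x y" for x y
    unfolding edge_form_def M_def s\<^sub>H_def t\<^sub>H_def using m(4) by (simp add: sum.reindex \<omega>)
  \<comment> \<open>A function pulled back along \<open>r\<close> factors through \<phi>, so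
    \<open>M_form\<close> turns its energy into one on \<open>H\<close>.\<close>
  have comp_r: "x \<circ> r = (x \<circ> rep) \<circ> \<phi>" for x :: "'v \<Rightarrow> real" by (simp add: r_def comp_assoc)
  have hull_G: "affine hull (p ` verts G) = UNIV"
    using hull_H m(2) by (metis image_comp p_def)
  have r: "r v \<in> verts G" "r (r v) = r v" "p (r v) = p v" if "v \<in> verts G" for v
    using rep \<phi>[OF that] by (auto simp: r_def p_def)
  obtain B where B: "B \<subseteq> verts G" "\<And>v. v \<in> B \<Longrightarrow> r v = v" "affine hull (p ` B) = UNIV"
      "\<And>x :: 'v \<Rightarrow> real. \<exists>a b. \<forall>v\<in>B. x v = b + a \<bullet> p v"
    using affine_base_vertices[OF hull_G r] by blast
  interpret contraction "verts G" "edges G" M s t r \<omega> p B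
  proof
    show "M \<subseteq> edges G" using m(5) by (auto simp: M_def)
    show "r (s e) \<noteq> r (t e)" if e: "e \<in> M" for e
    proof -
      obtain f where f: "f \<in> edges H" "e = \<psi> f" using e by (auto simp: M_def)
      then have "e \<in> edges G" using m(5) by blast
      then show ?thesis using H.ends_neq[OF f(1)] \<phi>_r G.ends_verts f(2) by (metis s\<^sub>H_def t\<^sub>H_def)
    qed
    show "(v, r v) \<in> {(a, b). \<exists>e\<in>edges G. r (s e) = r (t e) \<and> (a = s e \<and> b = t e \<or> a = t e \<and> b = s e)}\<^sup>*"
      (is "_ \<in> ?R\<^sup>*") if v: "v \<in> verts G" for v
    proof -
      have "fibre_adjacency G (verts G) \<phi> \<subseteq> ?R"
      proof (rule subrelI)
        fix a b assume "(a, b) \<in> fibre_adjacency G (verts G) \<phi>"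
        then obtain e where "e \<in> edges G" "Upair (s e) (t e) = Upair a b" "r a = r b"
          by (auto simp: fibre_adjacency_def adjacency_def st r_def)
        then show "(a, b) \<in> ?R" by (auto intro!: bexI[of _ e])
      qed
      moreover have "(v, r v) \<in> (fibre_adjacency G (verts G) \<phi>)\<^sup>*"
        using m(3) v r(1) \<phi>_r by simp
      ultimately show ?thesis using rtrancl_mono by blast
    qed
    show "\<omega> e \<noteq> 0" if "e \<in> M" for e
      using that \<omega> sign_H by (force simp: M_def)
    show "edge_form s t M \<omega> (x \<circ> r) (\<lambda>v. p v $ k) = 0" for x k
      using M_form[of "x \<circ> rep" "\<lambda>v. p\<^sub>H v $ k"] stress_H unfolding comp_r
      by (simp add: p_def comp_def)
    show "0 \<le> edge_form s t M \<omega> (x \<circ> r) (x \<circ> r)" for x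
      unfolding comp_r M_form by (rule psd_H)
    show "\<exists>a b. \<forall>v\<in>verts G. x (r v) = b + a \<bullet> p v" if "edge_form s t M \<omega> (x \<circ> r) (x \<circ> r) = 0" for x
    proof -
      have "H.form w\<^sub>H (x \<circ> rep) (x \<circ> rep) = 0" using that unfolding comp_r M_form .
      \<comment> \<open>Zero energy of a nonnegative form means membership in the kernel, which in
        \<open>H\<close> consists of affine functions.\<close>
      then have "\<forall>y. H.form w\<^sub>H y (x \<circ> rep) = 0"
        using sym_bilinear_form.psd_isotropic[OF edge_form_bilinear psd_H] by blast
      then show ?thesis using kernel_H[of "x \<circ> rep"] \<phi> by (fastforce simp: r_def p_def)
    qed
    show "S = 0" if "transpose S = S" "\<And>e. e \<in> M \<Longrightarrow> (p (s e) - p (t e)) \<bullet> (S *v (p (s e) - p (t e))) = 0"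
      for S :: "real ^ 'd ^ 'd"
      using rigid_H[OF that(1)] that(2) by (simp add: M_def p_def s\<^sub>H_def t\<^sub>H_def)
  qed (use G.finite_verts G.finite_edges G.ends_verts r B in auto)
  obtain w and p' :: "'v \<Rightarrow> real ^ 'd" where w: "\<forall>e\<in>edges G. w e \<noteq> 0"
    and data: "affine hull (p' ` verts G) = UNIV" "\<forall>k x. G.form w x (\<lambda>v. p' v $ k) = 0" "\<forall>x. G.form w x x \<ge> 0"
    "\<forall>y. (\<forall>x. G.form w x y = 0) \<longrightarrow> (\<exists>a b. \<forall>v\<in>verts G. y v = b + a \<bullet> p' v)"
    "\<forall>S. transpose S = S \<longrightarrow> (\<forall>e\<in>edges G. (p' (s e) - p' (t e)) \<bullet> (S *v (p' (s e) - p' (t e))) = 0) \<longrightarrow> S = 0"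
    using super_stable_data by blast
  \<comment> \<open>The signs on \<open>G\<close> are read off from the stress found, which makes it
    strictly proper.\<close>
  define \<sigma> where "\<sigma> e = (if w e > 0 then Plus else Minus)" for e
  have "\<forall>e\<in>edges G. sign_val (\<sigma> e) * w e > 0" using w by (auto simp: \<sigma>_def)
  then have "super_stable G \<sigma> p'" unfolding G.super_stable_iff using data by blast
  then show ?thesis by blast
qed

end
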